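(* Suppose that for any $i,j\in I$ with $i\neq j$ the matrix $\begin{pmatrix} a_{ii} & a_{ij}\\ a_{ji} & a_{jj}\end{pmatrix}$ is invertible and that, in addition, there exists a pair of indices $i,j\in I$ such that $a_{ij}=-1$. Then the Yangian $Y(\mathfrak g')$ is isomorphic to the algebra generated by $\{x_{ir}^{\pm},h_{ir}\}_{i\in I,\,r\in\{0,1\}}$ subject only to the following relations (for all $i,j\in I$), where $\tilde h_{i1}=h_{i1}-\tfrac12 h_{i0}^2$: $$[h_{ir},h_{js}]=0\quad(0\le r,s\le 1),$$ $$[h_{i0},x_{js}^{\pm}]=\pm(\alpha_i,\alpha_j)x_{js}^{\pm}\quad(s=0,1),$$ $$[x_{ir}^{+},x_{js}^{-}]=\delta_{ij}h_{i,r+s}\quad(0\le r+s\le 1),$$ $$[\tilde h_{i1},x_{j0}^{\pm}]=\pm(\alpha_i,\alpha_j)x_{j1}^{\pm},$$ $$[x_{i1}^{\pm},x_{j0}^{\pm}]-[x_{i0}^{\pm},x_{j1}^{\pm}]=\pm\frac{(\alpha_i,\alpha_j)}{2}\left(x_{i0}^{\pm}x_{j0}^{\pm}+x_{j0}^{\pm}x_{i0}^{\pm}\right),$$ $$\mathrm{ad}(x_{i0}^{\pm})^{1-a_{ij}}(x_{j0}^{\pm})=0\quad\text{if } i\neq j.$$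
   Context: All algebras are associative unital algebras over $\mathbb C$, and $[a,b]=ab-ba$. Let $\mathfrak g$ be a symmetrizable Kac--Moody algebra over $\mathbb C$ with indecomposable (generalized) Cartan matrix $(a_{ij})_{i,j\in I}$, simple roots $\alpha_i$, not of type $A_1^{(1)}$. Fix the standard nondegenerate invariant symmetric bilinear form $(\cdot,\cdot)$ on $\mathfrak g$ (so that, for the induced form on weights, $(\alpha_i,\alpha_i)>0$ and $a_{ij}=2(\alpha_i,\alpha_j)/(\alpha_i,\alpha_i)$). Let $\mathfrak g'=[\mathfrak g,\mathfrak g]$. The Yangian $Y(\mathfrak g')$ (with deformation parameter $\hbar=1$) is the algebra with generators $x_{ir}^{\pm},h_{ir}$ ($i\in I$, $r\in\mathbb Z_{\ge0}$) and defining relations, for all $i,j\in I$ and $r,s\geq 0$: $[h_{ir},h_{js}]=0$; $[h_{i0},x_{js}^{\pm}]=\pm(\alpha_i,\alpha_j)x_{js}^{\pm}$; $[x_{ir}^{+},x_{js}^{-}]=\delta_{ij}h_{i,r+s}$; $[h_{i,r+1},x_{js}^{\pm}]-[h_{ir},x_{j,s+1}^{\pm}]=\pm\frac{(\alpha_i,\alpha_j)}2(h_{ir}x_{js}^{\pm}+x_{js}^{\pm}h_{ir})$; $[x_{i,r+1}^{\pm},x_{js}^{\pm}]-[x_{ir}^{\pm},x_{j,s+1}^{\pm}]=\pm\frac{(\alpha_i,\alpha_j)}2(x_{ir}^{\pm}x_{js}^{\pm}+x_{js}^{\pm}x_{ir}^{\pm})$; and, for $i\ne j$, $b=1-a_{ij}$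 and all $r_1,\dots,r_b,s\ge0$, $\sum_{\sigma\in S_b}[x_{ir_{\sigma(1)}}^{\pm},[x_{ir_{\sigma(2)}}^{\pm},\cdots,[x_{ir_{\sigma(b)}}^{\pm},x_{js}^{\pm}]\cdots]]=0$. *)

theory Defs
  imports
    "HOL-Analysis.Analysis"
    "HOL-Library.Poly_Mapping"
    "HOL-Algebra.QuotRing"
    "HOL-Algebra.Module"
begin

section \<open>Associative unital complex algebras given by generators and relations\<close>

text \<open>
  The free algebra on a set of generators is the monoid algebra of the free monoid. Lists are
  wrapped in a new type in order to carry concatenation as (noncommutative) addition, the
  operation from which \<^type>\<open>poly_mapping\<close> builds its convolution product.
\<close>

datatype 'g free_monoid = Word (letters: "'g list")

instantiation free_monoid :: (type) monoid_add
begin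

definition zero_free_monoid :: "'a free_monoid" where
  "zero_free_monoid = Word []"

definition plus_free_monoid :: "'a free_monoid \<Rightarrow> 'a free_monoid \<Rightarrow> 'a free_monoid" where
  "plus_free_monoid u v = Word (letters u @ letters v)"

instance
  by standard (simp_all add: zero_free_monoid_def plus_free_monoid_def)

end

type_synonym 'g nc_poly = "'g free_monoid \<Rightarrow>\<^sub>0 complex"

definition gen :: "'g \<Rightarrow> 'g nc_poly" where
  "gen g = Poly_Mapping.single (Word [g]) 1"

definition const :: "complex \<Rightarrow> 'g nc_poly" where
  "const c = Poly_Mapping.single 0 c"

text \<open>
  A complex algebra is represented by a \<^type>\<open>module\<close> record, i.e. a ring together with a
  scalar multiplication by complex numbers.
\<close>

definition free_algebra :: "'g set \<Rightarrow> (complex, 'g nc_poly) module" where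
  "free_algebra G =
    \<lparr>carrier = {p. \<forall>w \<in> Poly_Mapping.keys p. set (letters w) \<subseteq> G},
     mult = (*), one = 1, zero = 0, add = (+),
     smult = (\<lambda>c p. const c * p)\<rparr>"

definition quotient_algebra :: "(complex, 'a) module \<Rightarrow> 'a set \<Rightarrow> (complex, 'a set) module" where
  "quotient_algebra F J =
    \<lparr>carrier = carrier (F Quot J), mult = mult (F Quot J), one = one (F Quot J),
     zero = zero (F Quot J), add = add (F Quot J),
     smult = (\<lambda>c X. \<Union>p\<in>X. J +>\<^bsub>F\<^esub> (c \<odot>\<^bsub>F\<^esub> p))\<rparr>"

text \<open>The elements of \<open>R\<close> are the expressions that are set to zero.\<close>

definition presented_algebra ::
  "'g set \<Rightarrow> 'g nc_poly set \<Rightarrow> (complex, 'g nc_poly set) module" where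
  "presented_algebra G R = quotient_algebra (free_algebra G) (Idl\<^bsub>free_algebra G\<^esub> R)"

definition algebra_iso :: "(complex, 'a) module \<Rightarrow> (complex, 'b) module \<Rightarrow> ('a \<Rightarrow> 'b) set" where
  "algebra_iso S T =
    {\<phi> \<in> ring_iso S T. \<forall>c. \<forall>a \<in> carrier S. \<phi> (c \<odot>\<^bsub>S\<^esub> a) = c \<odot>\<^bsub>T\<^esub> \<phi> a}"

definition algebras_isomorphic :: "(complex, 'a) module \<Rightarrow> (complex, 'b) module \<Rightarrow> bool" where
  "algebras_isomorphic S T \<longleftrightarrow> algebra_iso S T \<noteq> {}"

definition commutator :: "'a::ring \<Rightarrow> 'a \<Rightarrow> 'a" where
  "commutator a b = a * b - b * a"


section \<open>Generalized Cartan matrices\<close>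

definition generalized_cartan_matrix :: "('i::finite \<Rightarrow> 'i \<Rightarrow> int) \<Rightarrow> bool" where
  "generalized_cartan_matrix A \<longleftrightarrow>
    (\<forall>i. A i i = 2) \<and> (\<forall>i j. i \<noteq> j \<longrightarrow> A i j \<le> 0) \<and> (\<forall>i j. A i j = 0 \<longrightarrow> A j i = 0)"

definition indecomposable :: "('i::finite \<Rightarrow> 'i \<Rightarrow> int) \<Rightarrow> bool" where
  "indecomposable A \<longleftrightarrow>
    \<not> (\<exists>S. S \<noteq> {} \<and> S \<noteq> UNIV \<and> (\<forall>i\<in>S. \<forall>j\<in>-S. A i j = 0 \<and> A j i = 0))"

definition type_A1_1 :: "('i::finite \<Rightarrow> 'i \<Rightarrow> int) \<Rightarrow> bool" where
  "type_A1_1 A \<longleftrightarrow>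
    (\<exists>i j. i \<noteq> j \<and> UNIV = {i, j} \<and> A i i = 2 \<and> A i j = -2 \<and> A j i = -2 \<and> A j j = 2)"

text \<open>
  \<open>B i j\<close> stands for \<open>(\<alpha>\<^sub>i, \<alpha>\<^sub>j)\<close>, the values on simple roots of the form induced by a standard
  invariant form of the Kac--Moody algebra of \<open>A\<close>. A generalized Cartan matrix is symmetrizable
  precisely if such a \<open>B\<close> exists, and the standard forms correspond to the choices of \<open>B\<close>; the
  Kac--Moody algebra enters the Yangian only through \<open>A\<close> and \<open>B\<close>.
\<close>

definition standard_form_on_simple_roots ::
  "('i::finite \<Rightarrow> 'i \<Rightarrow> int) \<Rightarrow> ('i \<Rightarrow> 'i \<Rightarrow> real) \<Rightarrow> bool" where
  "standard_form_on_simple_roots A B \<longleftrightarrow>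
    (\<forall>i j. B i j = B j i) \<and> (\<forall>i. B i i > 0) \<and>
    (\<forall>i j. of_int (A i j) = 2 * B i j / B i i)"

definition principal_submatrix :: "('i::finite \<Rightarrow> 'i \<Rightarrow> int) \<Rightarrow> 'i \<Rightarrow> 'i \<Rightarrow> real^2^2" where
  "principal_submatrix A i j =
    vector [vector [of_int (A i i), of_int (A i j)],
            vector [of_int (A j i), of_int (A j j)]]"


section \<open>The Yangian and the reduced presentation\<close>

datatype sign = Plus | Minus

fun sgn_of :: "sign \<Rightarrow> real" where
  "sgn_of Plus = 1"
| "sgn_of Minus = -1"

datatype 'i ygen = Xgen sign 'i nat | Hgen 'i nat

abbreviation xg :: "sign \<Rightarrow> 'i \<Rightarrow> nat \<Rightarrow> 'i ygen nc_poly" where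
  "xg e i r \<equiv> gen (Xgen e i r)"

abbreviation hg :: "'i \<Rightarrow> nat \<Rightarrow> 'i ygen nc_poly" where
  "hg i r \<equiv> gen (Hgen i r)"

inductive_set yangian_relators ::
    "('i::finite \<Rightarrow> 'i \<Rightarrow> int) \<Rightarrow> ('i \<Rightarrow> 'i \<Rightarrow> real) \<Rightarrow> 'i ygen nc_poly set"
  for A :: "'i \<Rightarrow> 'i \<Rightarrow> int" and B :: "'i \<Rightarrow> 'i \<Rightarrow> real" where
  hh: "commutator (hg i r) (hg j s) \<in> yangian_relators A B"
| h0x: "commutator (hg i 0) (xg e j s) - const (of_real (sgn_of e * B i j)) * xg e j s
    \<in> yangian_relators A B"
| xpm: "commutator (xg Plus i r) (xg Minus j s) - (if i = j then hg i (r + s) else 0)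
    \<in> yangian_relators A B"
| hx: "commutator (hg i (Suc r)) (xg e j s) - commutator (hg i r) (xg e j (Suc s))
      - const (of_real (sgn_of e * B i j / 2)) * (hg i r * xg e j s + xg e j s * hg i r)
    \<in> yangian_relators A B"
| xx: "commutator (xg e i (Suc r)) (xg e j s) - commutator (xg e i r) (xg e j (Suc s))
      - const (of_real (sgn_of e * B i j / 2)) * (xg e i r * xg e j s + xg e j s * xg e i r)
    \<in> yangian_relators A B"
| serre: "\<lbrakk>i \<noteq> j; b = nat (1 - A i j)\<rbrakk> \<Longrightarrow>
    (\<Sum>\<sigma> | \<sigma> permutes {..<b}.
        foldr (\<lambda>k. commutator (xg e i (r (\<sigma> k)))) [0..<b] (xg e j s))
    \<in> yangian_relators A B"

definition yangian ::
  "('i::finite \<Rightarrow> 'i \<Rightarrow> int) \<Rightarrow> ('i \<Rightarrow> 'i \<Rightarrow> real) \<Rightarrow> (complex, 'i ygen nc_poly set) module" where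
  "yangian A B = presented_algebra UNIV (yangian_relators A B)"

definition reduced_generators :: "'i ygen set" where
  "reduced_generators = {Xgen e i r | e i r. r \<in> {0, 1}} \<union> {Hgen i r | i r. r \<in> {0, 1}}"

definition htilde1 :: "'i \<Rightarrow> 'i ygen nc_poly" where
  "htilde1 i = hg i 1 - const (1/2) * hg i 0 ^ 2"

inductive_set reduced_relators ::
    "('i::finite \<Rightarrow> 'i \<Rightarrow> int) \<Rightarrow> ('i \<Rightarrow> 'i \<Rightarrow> real) \<Rightarrow> 'i ygen nc_poly set"
  for A :: "'i \<Rightarrow> 'i \<Rightarrow> int" and B :: "'i \<Rightarrow> 'i \<Rightarrow> real" where
  hh: "\<lbrakk>r \<le> 1; s \<le> 1\<rbrakk> \<Longrightarrow> commutator (hg i r) (hg j s) \<in> reduced_relators A B"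
| h0x: "s \<le> 1 \<Longrightarrow>
    commutator (hg i 0) (xg e j s) - const (of_real (sgn_of e * B i j)) * xg e j s
    \<in> reduced_relators A B"
| xpm: "r + s \<le> 1 \<Longrightarrow>
    commutator (xg Plus i r) (xg Minus j s) - (if i = j then hg i (r + s) else 0)
    \<in> reduced_relators A B"
| htx: "commutator (htilde1 i) (xg e j 0) - const (of_real (sgn_of e * B i j)) * xg e j 1
    \<in> reduced_relators A B"
| xx: "commutator (xg e i 1) (xg e j 0) - commutator (xg e i 0) (xg e j 1)
      - const (of_real (sgn_of e * B i j / 2)) * (xg e i 0 * xg e j 0 + xg e j 0 * xg e i 0)
    \<in> reduced_relators A B"
| serre: "i \<noteq> j \<Longrightarrow>
    (commutator (xg e i 0) ^^ nat (1 - A i j)) (xg e j 0) \<in> reduced_relators A B"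

definition reduced_yangian ::
  "('i::finite \<Rightarrow> 'i \<Rightarrow> int) \<Rightarrow> ('i \<Rightarrow> 'i \<Rightarrow> real) \<Rightarrow> (complex, 'i ygen nc_poly set) module" where
  "reduced_yangian A B = presented_algebra reduced_generators (reduced_relators A B)"

end

theory Submission
  imports Defs
begin

text \<open>
  The theorem comes down to one computation. Suppose that elements $x_{i0}^\pm, x_{i1}^\pm, h_{i0},
  h_{i1}$ of some algebra satisfy the reduced relations, and define further elements by
  $x_{i,r+1}^\pm = \pm(\alpha_i,\alpha_i)^{-1}[\tilde h_{i1}, x_{ir}^\pm]$ and
  $h_{ir} = [x_{ir}^+, x_{i0}^-]$. Then all relations of the Yangian hold. Conversely these two
  formulas are consequences of the Yangian relations, so that the generators of degree at least
  two are redundant there, and the two algebras are the same.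

  For the computation, note first that $\tilde h_{k1}$ raises degrees:
  $[\tilde h_{k1}, x_{jr}^\pm] = \pm(\alpha_k,\alpha_j)x_{j,r+1}^\pm$. Bracketing a relation between
  generators for two indices $i \neq j$ with $\tilde h_{i1}$ and with $\tilde h_{j1}$ gives two linear
  equations for the two neighbouring relations of the next degree. Their determinant
  $(\alpha_i,\alpha_i)(\alpha_j,\alpha_j) - (\alpha_i,\alpha_j)^2$ is nonzero by hypothesis, so these
  relations propagate to all degrees (\<open>determinant_grid_zero\<close>).

  If the two indices coincide, the two equations are the same one, and elements are needed that
  shift degrees by more than one. They are the Newton power sums of $1, h_{j0}, h_{j1}, \dots$,
  regarded as complete symmetric functions: if $c = \pm(\alpha_j,\alpha_i)/2$ and
  $\sigma$ is the shift $x_{is}^\pm \mapsto x_{i,s+1}^\pm$, the $n$-th power sum acts on the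
  $x_{is}^\pm$ by $(\sigma+c)^n - (\sigma-c)^n$, whose leading term is $2nc\,\sigma^{n-1}$
  (\<open>commutator_newton\<close>). For $j \neq i$ with $(\alpha_i,\alpha_j) \neq 0$ this is available before
  anything is known about the index $i$ alone.

  The crucial point is that $[x_{ir}^+, x_{is}^-]$ depends on $r+s$ only. Suppose that this holds for
  $r+s \le N$ and all $i$. Bracketing with $\tilde h_{i1}$ shows that for $r+s = N+1$ the values form
  an arithmetic progression, with a difference $D_i$ that measures $[\tilde h_{i1}, h_{iN}]$. For a
  neighbour $j$ of $i$, the bracket of $h_{i1}$ with the power sum of degree $N+1$ of the $h_{jr}$
  can be evaluated in two ways, and the comparison yields $D_j = -N D_i$
  (\<open>flat_difference_neighbour\<close>). By symmetry $D_i = -N D_j$, hence $(N^2-1)D_i = 0$; and for $N = 1$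
  the vanishing of $D_i$ follows from $[\tilde h_{i1}, h_{i1}] = 0$.

  After that the power sums of all $h_{jr}$ are at our disposal. They give the remaining relations
  between the $x_{ir}^\pm$ and $x_{is}^\pm$, the commutativity of the $h_{ir}$ and, by an
  argument on symmetric functions, the Serre relations in all degrees (\<open>sym_ad_zero\<close>).

  The computation takes place in a type of class \<^class>\<open>real_algebra_1\<close>. The quotient of a free
  algebra by an ideal is not a type, but it embeds into the linear endomorphisms of the free
  algebra (\<open>ideal_is_kernel\<close>), and this suffices to test membership in the ideal.
\<close>

section \<open>Commutators and the relations that shift degrees\<close>

lemma commutator_linear:
  fixes a b c :: "'a::real_algebra"
  shows "commutator (a + b) c = commutator a c + commutator b c"
    and "commutator c (a + b) = commutator c a + commutator c b"
    and "commutator (a - b) c = commutator a c - commutator b c"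
    and "commutator c (a - b) = commutator c a - commutator c b"
    and "commutator (t *\<^sub>R a) c = t *\<^sub>R commutator a c"
    and "commutator c (t *\<^sub>R a) = t *\<^sub>R commutator c a"
    and "commutator 0 c = 0" and "commutator c 0 = 0"
    and "commutator (- a) c = - commutator a c" and "commutator c (- a) = - commutator c a"
  by (simp_all add: commutator_def algebra_simps)

lemma commutator_sum:
  fixes c :: "'a::real_algebra"
  shows "commutator (\<Sum>k\<in>K. f k) c = (\<Sum>k\<in>K. commutator (f k) c)"
    and "commutator c (\<Sum>k\<in>K. f k) = (\<Sum>k\<in>K. commutator c (f k))"
  by (simp_all add: commutator_def sum_distrib_left sum_distrib_right sum_subtractf)

lemma commutator_mult_right:
  fixes a b c :: "'a::real_algebra"
  shows "commutator a (b * c) = commutator a b * c + b * commutator a c"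
    and "commutator (b * c) a = b * commutator c a + commutator b a * c"
  by (simp_all add: commutator_def algebra_simps)

lemma commutator_jacobi:
  fixes a b c :: "'a::real_algebra"
  shows "commutator g (commutator a b) = commutator (commutator g a) b + commutator a (commutator g b)"
  by (simp add: commutator_def algebra_simps)

lemma commutator_swap: "commutator a b = - commutator b (a::'a::real_algebra)"
  by (simp add: commutator_def)

lemma commutator_mult_zero:
  fixes g :: "'a::real_algebra"
  assumes "commutator g a = 0" "commutator g b = 0"
  shows "commutator g (a * b) = 0"
  using assms by (simp add: commutator_mult_right)

lemma determinant_zero:
  fixes u v :: "'a::real_vector"
  assumes "a *\<^sub>R u + b *\<^sub>R v = 0" "a' *\<^sub>R u + b' *\<^sub>R v = 0" and det: "a * b' - a' * b \<noteq> 0"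
  shows "u = 0" "v = 0"
proof -
  have "(a * b' - a' * b) *\<^sub>R u = b' *\<^sub>R (a *\<^sub>R u + b *\<^sub>R v) - b *\<^sub>R (a' *\<^sub>R u + b' *\<^sub>R v)"
    by (simp add: algebra_simps)
  then show "u = 0" using assms by simp
  have "(a * b' - a' * b) *\<^sub>R v = a *\<^sub>R (a' *\<^sub>R u + b' *\<^sub>R v) - a' *\<^sub>R (a *\<^sub>R u + b *\<^sub>R v)"
    by (simp add: algebra_simps)
  then show "v = 0" using assms by simp
qed

text \<open>
  \<open>Z r s\<close> will be the defect of a relation in degrees \<open>r\<close> and \<open>s\<close>; the two equations come from
  two elements that raise degrees. They determine both defects of the next total degree.
\<close>
lemma determinant_grid_zero:
  fixes Z :: "nat \<Rightarrow> nat \<Rightarrow> 'a::real_vector"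
  assumes "Z 0 0 = 0"
    and "\<And>r s. Z r s = 0 \<Longrightarrow> a *\<^sub>R Z (Suc r) s + b *\<^sub>R Z r (Suc s) = 0"
    and "\<And>r s. Z r s = 0 \<Longrightarrow> a' *\<^sub>R Z (Suc r) s + b' *\<^sub>R Z r (Suc s) = 0"
    and "a * b' - a' * b \<noteq> 0"
  shows "Z r s = 0"
proof (induction "r + s" arbitrary: r s)
  case 0
  then show ?case using assms(1) by simp
next
  case (Suc n)
  show ?case
  proof (cases r)
    case 0
    then obtain t where "s = Suc t" using Suc.hyps(2) by (cases s) auto
    with 0 Suc have "Z r t = 0" by simp
    with determinant_zero(2)[OF assms(2) assms(3) assms(4)] \<open>s = Suc t\<close> show ?thesis by blast
  next
    case (Suc t)
    with Suc.hyps have "Z t s = 0" by simp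
    with determinant_zero(1)[OF assms(2) assms(3) assms(4)] Suc show ?thesis by blast
  qed
qed

text \<open>
  The defect of the relations between consecutive degrees. The same expression serves for \<open>x\<close>
  against \<open>x\<close> and for \<open>h\<close> against \<open>x\<close>; it is symmetric in the two sequences, which is what
  makes the case of two equal sequences tractable.
\<close>
definition drinfeld ::
  "real \<Rightarrow> (nat \<Rightarrow> 'a::real_algebra) \<Rightarrow> (nat \<Rightarrow> 'a) \<Rightarrow> nat \<Rightarrow> nat \<Rightarrow> 'a" where
  "drinfeld c x y r s =
    commutator (x (Suc r)) (y s) - commutator (x r) (y (Suc s)) - c *\<^sub>R (x r * y s + y s * x r)"

lemma drinfeld_swap: "drinfeld c x y r s = drinfeld c y x s r"
  by (simp add: drinfeld_def commutator_def algebra_simps)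

lemma commutator_drinfeld:
  "commutator g (drinfeld c x y r s) =
    drinfeld c (\<lambda>r. commutator g (x r)) y r s + drinfeld c x (\<lambda>s. commutator g (y s)) r s"
  by (simp add: drinfeld_def commutator_def algebra_simps)

lemma drinfeld_shifts_left:
  "drinfeld c (\<lambda>r. \<Sum>q\<in>Q. \<phi> q *\<^sub>R x (r + q)) y r s = (\<Sum>q\<in>Q. \<phi> q *\<^sub>R drinfeld c x y (r + q) s)"
proof -
  show ?thesis
    unfolding drinfeld_def commutator_linear commutator_sum add_Suc scaleR_diff_right scaleR_add_right
      sum_subtractf sum.distrib sum_distrib_left sum_distrib_right scaleR_sum_right
    by (simp only: mult_scaleR_left mult_scaleR_right scaleR_left_commute[of c])
qed

lemma drinfeld_shifts_right:
  "drinfeld c x (\<lambda>s. \<Sum>q\<in>Q. \<phi> q *\<^sub>R y (s + q)) r s = (\<Sum>q\<in>Q. \<phi> q *\<^sub>R drinfeld c x y r (s + q))"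
  unfolding drinfeld_swap[of c x] by (rule drinfeld_shifts_left)

lemma commutator_drinfeld_shifts:
  assumes "\<And>r. commutator g (x r) = (\<Sum>q\<in>P. \<phi> q *\<^sub>R x (r + q))"
    and "\<And>s. commutator g (y s) = (\<Sum>q\<in>Q. \<psi> q *\<^sub>R y (s + q))"
  shows "commutator g (drinfeld c x y r s) =
    (\<Sum>q\<in>P. \<phi> q *\<^sub>R drinfeld c x y (r + q) s) + (\<Sum>q\<in>Q. \<psi> q *\<^sub>R drinfeld c x y r (s + q))"
  by (simp add: commutator_drinfeld assms drinfeld_shifts_left drinfeld_shifts_right)

lemma commutator_drinfeld_Suc:
  assumes "\<And>r. commutator g (x r) = a *\<^sub>R x (Suc r)" and "\<And>s. commutator g (y s) = b *\<^sub>R y (Suc s)"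
  shows "commutator g (drinfeld c x y r s) =
    a *\<^sub>R drinfeld c x y (Suc r) s + b *\<^sub>R drinfeld c x y r (Suc s)"
  using commutator_drinfeld_shifts[of g x "\<lambda>_. a" "{1}" y "\<lambda>_. b" "{1}" c r s] assms by simp

section \<open>Newton power sums\<close>

text \<open>The operator $\sigma + c$ on sequences, where $\sigma$ is the shift.\<close>
definition up :: "real \<Rightarrow> (nat \<Rightarrow> 'a::real_vector) \<Rightarrow> nat \<Rightarrow> 'a" where
  "up c x s = x (Suc s) + c *\<^sub>R x s"

lemma up_commute: "up c (up d x) = up d (up c x)"
  by (simp add: up_def fun_eq_iff algebra_simps)

lemma up_funpow_commute: "(up c ^^ n) (up d x) = up d ((up c ^^ n) x)"
  by (induction n) (simp_all add: up_commute)

lemma up_funpow: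
  "(up c ^^ n) x s = (\<Sum>k\<le>n. (real (n choose k) * c ^ (n - k)) *\<^sub>R x (s + k))"
proof (induction n arbitrary: s)
  case 0
  then show ?case by simp
next
  case (Suc n)
  have "(\<Sum>k\<le>Suc n. (real (Suc n choose k) * c ^ (Suc n - k)) *\<^sub>R x (s + k))
    = c ^ Suc n *\<^sub>R x s + (\<Sum>k\<le>n. (real (Suc n choose Suc k) * c ^ (n - k)) *\<^sub>R x (Suc s + k))"
    by (subst sum.atMost_Suc_shift) simp
  also have "\<dots> = (c ^ Suc n *\<^sub>R x s + (\<Sum>k\<le>n. (real (n choose Suc k) * c ^ (n - k)) *\<^sub>R x (s + Suc k)))
      + (up c ^^ n) x (Suc s)"
    by (simp add: Suc scaleR_left_distrib distrib_right sum.distrib)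
  also have "c ^ Suc n *\<^sub>R x s + (\<Sum>k\<le>n. (real (n choose Suc k) * c ^ (n - k)) *\<^sub>R x (s + Suc k))
      = (\<Sum>k\<le>Suc n. (real (n choose k) * c ^ (Suc n - k)) *\<^sub>R x (s + k))"
    by (subst sum.atMost_Suc_shift) simp
  also have "\<dots> = (\<Sum>k\<le>n. (real (n choose k) * c ^ Suc (n - k)) *\<^sub>R x (s + k))"
    by (simp add: Suc_diff_le)
  also have "\<dots> = c *\<^sub>R (up c ^^ n) x s"
    by (simp add: Suc scaleR_sum_right mult.left_commute)
  finally have "(\<Sum>k\<le>Suc n. (real (Suc n choose k) * c ^ (Suc n - k)) *\<^sub>R x (s + k))
      = c *\<^sub>R (up c ^^ n) x s + (up c ^^ n) x (Suc s)" .
  then show ?case by (simp only: up_def[of c "(up c ^^ n) x"] funpow.simps comp_apply add.commute)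
qed

text \<open>
  The coefficient of $\sigma^k$ in $(\sigma+c)^{n+1} - (\sigma-c)^{n+1}$. It is odd in \<open>c\<close>, so
  the sign of a generator enters only as a global factor.
\<close>
definition power_sum_coeff :: "real \<Rightarrow> nat \<Rightarrow> nat \<Rightarrow> real" where
  "power_sum_coeff c n k = real (Suc n choose k) * (c ^ (Suc n - k) - (- c) ^ (Suc n - k))"

lemma power_sum_coeff_top: "power_sum_coeff c n n = 2 * real (Suc n) * c"
  by (simp add: power_sum_coeff_def Suc_diff_le)

lemma power_sum_coeff_uminus: "power_sum_coeff (- c) n k = - power_sum_coeff c n k"
  by (simp add: power_sum_coeff_def algebra_simps)

lemma up_funpow_diff:
  "(up c ^^ Suc n) x s - (up (- c) ^^ Suc n) x s = (\<Sum>k\<le>n. power_sum_coeff c n k *\<^sub>R x (s + k))"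
  unfolding up_funpow power_sum_coeff_def right_diff_distrib scaleR_left_diff_distrib sum_subtractf
  by simp

text \<open>
  Newton's recursion for the coefficients of $z H'(z) H(z)^{-1}$, where $H(z) = \sum_n a_n z^n$. The
  order of the factors is fixed, since the \<open>a n\<close> are not known to commute with each other when the
  recursion is first used.
\<close>
function newton :: "(nat \<Rightarrow> 'a::real_algebra_1) \<Rightarrow> nat \<Rightarrow> 'a" where
  "newton a n = real n *\<^sub>R a n - (\<Sum>m<n. newton a m * a (n - m))"
  by auto
termination by (relation "Wellfounded.measure snd") auto

declare newton.simps [simp del]

lemma newton_0 [simp]: "newton a 0 = 0"
  by (subst newton.simps) simp

lemma newton_identity:
  assumes "a 0 = 1"
  shows "(\<Sum>m\<le>n. newton a m * a (n - m)) = real n *\<^sub>R a n"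
  unfolding lessThan_Suc_atMost[symmetric] sum.lessThan_Suc
  by (subst (2) newton.simps) (simp add: assms)

text \<open>
  In generating functions, $H(z)(1 - z(\sigma+c))x = (1 - z(\sigma-c))x\,H(z)$ up to degree \<open>N\<close>:
  conjugation by $H(z)$ acts on the sequence \<open>x\<close> as a rational function of the shift.
\<close>
definition intertwines ::
  "nat \<Rightarrow> (nat \<Rightarrow> 'a::real_algebra_1) \<Rightarrow> real \<Rightarrow> (nat \<Rightarrow> 'a) \<Rightarrow> bool" where
  "intertwines N a c x \<longleftrightarrow>
    (\<forall>n<N. \<forall>s. commutator (a (Suc n)) (x s) = a n * up c x s - up (- c) x s * a n)"

text \<open>
  The condition is linear and invariant under shifts of \<open>x\<close>. Inductive proofs can therefore
  replace \<open>x\<close> by \<open>up d x\<close>.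
\<close>
lemma intertwines_up: "intertwines N a c x \<Longrightarrow> intertwines N a c (up d x)"
  unfolding intertwines_def
proof (intro allI impI)
  fix n s
  assume hyp: "\<forall>n<N. \<forall>s. commutator (a (Suc n)) (x s) = a n * up c x s - up (- c) x s * a n" and "n < N"
  then have step: "commutator (a (Suc n)) (x s) = a n * up c x s - up (- c) x s * a n" for s
    by blast
  show "commutator (a (Suc n)) (up d x s) = a n * up c (up d x) s - up (- c) (up d x) s * a n"
    unfolding up_def[of d] commutator_linear step by (simp add: up_def algebra_simps)
qed

lemma intertwines_expand:
  assumes "a 0 = 1" "intertwines N a c x" "n \<le> N"
  shows "a n * x s = (up c ^^ n) x s
    + (\<Sum>m<n. (up c ^^ m) x s * a (n - m) - (up c ^^ m) (up (- c) x) s * a (n - Suc m))"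
  using assms(2,3)
proof (induction n arbitrary: x)
  case 0
  then show ?case using assms(1) by simp
next
  case (Suc n)
  have "a (Suc n) * x s = x s * a (Suc n) + a n * up c x s - up (- c) x s * a n"
    using Suc.prems by (simp add: intertwines_def commutator_def algebra_simps)
  also have "a n * up c x s = (up c ^^ Suc n) x s
    + (\<Sum>m<n. (up c ^^ Suc m) x s * a (n - m) - (up c ^^ Suc m) (up (- c) x) s * a (n - Suc m))"
    using Suc.IH[OF intertwines_up[OF Suc.prems(1)]] Suc.prems
    by (simp add: up_funpow_commute up_commute)
  finally show ?case
    by (subst sum.lessThan_Suc_shift) (simp add: algebra_simps)
qed

text \<open>
  This is the logarithmic derivative of the intertwining relation: $T(z) =
  (1 - z(\sigma-c))/(1 - z(\sigma+c))$ has $z T'(z)/T(z) = \sum_n ((\sigma+c)^n - (\sigma-c)^n) z^n$.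
  The induction carries this out coefficientwise. The terms with powers of $\sigma - c$ telescope,
  and those with powers of $\sigma + c$ are collected by \<open>intertwines_expand\<close>.
\<close>
lemma commutator_newton:
  assumes "a 0 = 1" "intertwines N a c x" "n \<le> N"
  shows "commutator (newton a n) (x s) = (up c ^^ n) x s - (up (- c) ^^ n) x s"
  using assms(2,3)
proof (induction n arbitrary: x s rule: less_induct)
  case (less n)
  show ?case
  proof (cases n)
    case 0
    then show ?thesis by (simp add: commutator_linear)
  next
    case (Suc k)
    let ?p = "\<lambda>m. (up c ^^ m) x s" and ?q = "\<lambda>m. (up (- c) ^^ m) x s"
    let ?qx = "up (- c) x s" and ?pq = "\<lambda>m. (up c ^^ m) (up (- c) x) s"
    have a: "commutator (a (Suc m)) (x s) = a m * up c x s - ?qx * a m" if "m \<le> k" for m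
      using less.prems Suc that by (simp add: intertwines_def)
    have l: "newton a m * ?qx = ?qx * newton a m + (?pq m - ?q (Suc m))" if "m \<le> k" for m
    proof -
      have "commutator (newton a m) ?qx = ?pq m - ?q (Suc m)"
        using less.IH[OF _ intertwines_up[OF less.prems(1)], of m] less.prems Suc that
        by (simp add: up_funpow_commute)
      then show ?thesis by (simp add: commutator_def algebra_simps)
    qed
    have t: "commutator (newton a m * a (Suc k - m)) (x s)
        = newton a m * a (k - m) * up c x s - ?qx * (newton a m * a (k - m))
          - (?pq m * a (k - m) - ?p m * a (Suc k - m)) + (?q (Suc m) * a (k - m) - ?q m * a (Suc k - m))"
      if "m \<le> k" for m
    proof -
      have IH: "commutator (newton a m) (x s) = ?p m - ?q m"
        using less.IH[OF _ less.prems(1)] less.prems Suc that by simp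
      have "commutator (newton a m * a (Suc k - m)) (x s)
        = newton a m * (a (k - m) * up c x s) - (newton a m * ?qx) * a (k - m)
          + (?p m - ?q m) * a (Suc k - m)"
        unfolding commutator_mult_right IH Suc_diff_le[OF that] a[OF diff_le_self]
        by (simp add: algebra_simps)
      then show ?thesis unfolding l[OF that] by (simp add: algebra_simps)
    qed
    \<comment> \<open>Besides the two powers, \<open>tele\<close> and \<open>expand\<close> leave the commutator of \<open>a (Suc k)\<close> with \<open>x s\<close>.
      It accounts for the difference between the factors \<open>real (Suc k)\<close> and \<open>real k\<close>.\<close>
    have tele: "(\<Sum>m\<le>k. ?q (Suc m) * a (k - m) - ?q m * a (Suc k - m)) = ?q (Suc k) - x s * a (Suc k)"
      using sum_lessThan_telescope[of "\<lambda>m. ?q m * a (Suc k - m)" "Suc k"] assms(1)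
      by (simp add: lessThan_Suc_atMost)
    have expand: "(\<Sum>m\<le>k. ?pq m * a (k - m) - ?p m * a (Suc k - m)) = ?p (Suc k) - a (Suc k) * x s"
    proof -
      have "a (Suc k) * x s
        = ?p (Suc k) + (\<Sum>m<Suc k. ?p m * a (Suc k - m) - ?pq m * a (Suc k - Suc m))"
        using intertwines_expand[OF assms(1) less.prems(1), of "Suc k" s] less.prems Suc by blast
      then show ?thesis
        by (simp add: lessThan_Suc_atMost sum_subtractf)
    qed
    have "(\<Sum>m\<le>k. commutator (newton a m * a (Suc k - m)) (x s))
      = (\<Sum>m\<le>k. newton a m * a (k - m)) * up c x s - ?qx * (\<Sum>m\<le>k. newton a m * a (k - m))
        - (\<Sum>m\<le>k. ?pq m * a (k - m) - ?p m * a (Suc k - m))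
        + (\<Sum>m\<le>k. ?q (Suc m) * a (k - m) - ?q m * a (Suc k - m))"
    proof -
      have "(\<Sum>m\<le>k. commutator (newton a m * a (Suc k - m)) (x s))
        = (\<Sum>m\<le>k. newton a m * a (k - m) * up c x s - ?qx * (newton a m * a (k - m))
          - (?pq m * a (k - m) - ?p m * a (Suc k - m)) + (?q (Suc m) * a (k - m) - ?q m * a (Suc k - m)))"
        by (rule sum.cong) (simp_all only: t atMost_iff)
      then show ?thesis
        by (simp only: sum.distrib sum_subtractf sum_distrib_left sum_distrib_right)
    qed
    also have "\<dots> = real k *\<^sub>R commutator (a (Suc k)) (x s) - (?p (Suc k) - a (Suc k) * x s)
        + (?q (Suc k) - x s * a (Suc k))"
      unfolding newton_identity[where a = a, OF assms(1)] tele expand a[OF order_refl]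
      by (simp add: scaleR_diff_right)
    finally show ?thesis
      unfolding Suc newton.simps[of a "Suc k"]
      unfolding lessThan_Suc_atMost commutator_linear commutator_sum
      by (simp only: of_nat_Suc scaleR_add_left scaleR_one commutator_def[of "a (Suc k)"])
        (simp only: algebra_simps)
  qed
qed

lemma commutator_newton_zero:
  assumes "\<And>m. m \<le> n \<Longrightarrow> commutator g (a m) = 0"
  shows "commutator g (newton a n) = 0"
  using assms
proof (induction n rule: less_induct)
  case (less n)
  then have "commutator g (newton a m * a (n - m)) = 0" if "m < n" for m
    using that by (intro commutator_mult_zero) auto
  then show ?case
    by (subst newton.simps) (simp add: commutator_linear commutator_sum less.prems)
qed

text \<open>
  Only the leading term \<open>real n *\<^sub>R a n\<close> of a power sum survives when everything of lower degree
  commutes with \<open>g\<close>; the summand with \<open>m = 0\<close>, which also contains \<open>a n\<close>, vanishes because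
  \<open>newton a 0 = 0\<close>.
\<close>
lemma commutator_newton_top:
  assumes "\<And>m. m < n \<Longrightarrow> commutator g (a m) = 0"
  shows "commutator g (newton a n) = real n *\<^sub>R commutator g (a n)"
proof -
  have "commutator g (newton a m * a (n - m)) = 0" if "m < n" for m
  proof (cases "m = 0")
    case True
    then show ?thesis by (simp add: commutator_linear)
  next
    case False
    with that show ?thesis
      by (intro commutator_mult_zero commutator_newton_zero assms) auto
  qed
  then show ?thesis
    by (subst newton.simps) (simp add: commutator_linear commutator_sum)
qed

section \<open>Raising the degree from the reduced relations\<close>

lemma commutator_exchange:
  fixes g h x :: "'a::real_algebra"
  assumes "commutator g h = 0"
  shows "commutator g (commutator h x) = commutator h (commutator g x)"
  using assms by (simp add: commutator_jacobi[of g h x] commutator_linear)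

lemma drinfeld_scale: "drinfeld c (\<lambda>r. t *\<^sub>R x r) y r s = t *\<^sub>R drinfeld c x y r s"
  using drinfeld_shifts_left[of c "\<lambda>_. t" x "{0}" y r s] by simp

lemma drinfeld_zero: "drinfeld c x (\<lambda>_. 0) r s = 0"
  by (simp add: drinfeld_def commutator_linear)

lemma diff_chain: "\<lbrakk>p - q = d; q - m = t\<rbrakk> \<Longrightarrow> p - m = d + (t::'a::ab_group_add)"
  by auto

lemma swap_scale_zero:
  fixes u v :: "'a::real_vector"
  assumes u: "u = - a *\<^sub>R v" and v: "v = - a *\<^sub>R u" and a: "a * a \<noteq> 1"
  shows "u = 0"
proof -
  have "u = (a * a) *\<^sub>R u"
    by (subst u, subst v) simp
  then have "(1 - a * a) *\<^sub>R u = 0"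
    by (simp only: scaleR_left_diff_distrib scaleR_one) simp
  with a show ?thesis by simp
qed

lemma sgn_of_sq [simp]: "sgn_of e * sgn_of e = 1" "sgn_of e * (sgn_of e * t) = t"
  by (cases e; simp)+

lemma sgn_of_nonzero [simp]: "sgn_of e \<noteq> 0"
  by (cases e) simp_all

fun opp :: "sign \<Rightarrow> sign" where
  "opp Plus = Minus"
| "opp Minus = Plus"

text \<open>
  Elements of an algebra that satisfy the reduced relations, together with the elements of higher
  degree that the recursions \<open>X_rec\<close> and \<open>H_rec\<close> build from them. The assumptions \<open>B_det\<close> and \<open>neighbour\<close>
  are the two consequences of the hypotheses on the Cartan matrix on which everything rests. The
  unit \<open>1\<close> serves as initial term of the power sums only, so images of the generators under a
  homomorphism that does not preserve units qualify as well.
\<close>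
locale reduced_yangian_elements =
  fixes A :: "'i::finite \<Rightarrow> 'i \<Rightarrow> int" and B :: "'i \<Rightarrow> 'i \<Rightarrow> real"
    and X :: "sign \<Rightarrow> 'i \<Rightarrow> nat \<Rightarrow> 'a::real_algebra_1" and H :: "'i \<Rightarrow> nat \<Rightarrow> 'a"
    and ht :: "'i \<Rightarrow> 'a"
  assumes B_sym: "B i j = B j i"
    and B_pos: "B i i > 0"
    and B_det: "i \<noteq> j \<Longrightarrow> B i i * B j j - B i j * B i j \<noteq> 0"
    and neighbour: "\<exists>j. j \<noteq> i \<and> B i j \<noteq> 0"
    and ht_def: "ht i = H i 1 - (1/2) *\<^sub>R (H i 0 * H i 0)"
    and H_H: "\<lbrakk>r \<le> 1; s \<le> 1\<rbrakk> \<Longrightarrow> commutator (H i r) (H j s) = 0"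
    and H0_X0: "commutator (H i 0) (X e j 0) = (sgn_of e * B i j) *\<^sub>R X e j 0"
    and X_X_low: "r + s \<le> 1 \<Longrightarrow>
      commutator (X Plus i r) (X Minus j s) = (if i = j then H i (r + s) else 0)"
    and ht_X0: "commutator (ht i) (X e j 0) = (sgn_of e * B i j) *\<^sub>R X e j 1"
    and drinfeld_00: "drinfeld (sgn_of e * B i j / 2) (X e i) (X e j) 0 0 = 0"
    and serre_0: "i \<noteq> j \<Longrightarrow> (commutator (X e i 0) ^^ nat (1 - A i j)) (X e j 0) = 0"
    and X_rec: "X e i (Suc (Suc r)) = (sgn_of e / B i i) *\<^sub>R commutator (ht i) (X e i (Suc r))"
    and H_rec: "H i (Suc (Suc r)) = commutator (X Plus i (Suc (Suc r))) (X Minus i 0)"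
begin

lemma B_nonzero [simp]: "B i i \<noteq> 0"
  using B_pos[of i] by simp

lemma H_ht: "r \<le> 1 \<Longrightarrow> commutator (H i r) (ht j) = 0"
  by (simp add: ht_def commutator_linear commutator_mult_right H_H)

lemma ht_H_low: "r \<le> 1 \<Longrightarrow> commutator (ht j) (H i r) = 0"
  using H_ht[of r i j] commutator_swap[of "ht j"] by simp

lemma ht_ht: "commutator (ht i) (ht j) = 0"
  by (simp add: ht_def[of i] commutator_linear commutator_mult_right H_ht)

lemma X_Suc: "X e i (Suc r) = (sgn_of e / B i i) *\<^sub>R commutator (ht i) (X e i r)"
  by (cases r) (simp_all add: X_rec ht_X0)

text \<open>
  The recursion uses \<open>ht j\<close> with the index of the generator; since the \<open>ht i\<close> commute, all of
  them raise the degree.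
\<close>
lemma ht_X: "commutator (ht i) (X e j r) = (sgn_of e * B i j) *\<^sub>R X e j (Suc r)"
proof (induction r)
  case 0
  then show ?case by (simp add: ht_X0)
next
  case (Suc r)
  have "commutator (ht i) (X e j (Suc r))
    = (sgn_of e / B j j) *\<^sub>R commutator (ht j) (commutator (ht i) (X e j r))"
    by (simp add: X_Suc[of e j r] commutator_linear commutator_exchange[OF ht_ht])
  also have "\<dots> = (sgn_of e * B i j) *\<^sub>R X e j (Suc (Suc r))"
    by (simp add: Suc X_Suc[of e j "Suc r"] commutator_linear mult.commute)
  finally show ?case .
qed

lemma H0_X: "commutator (H i 0) (X e j r) = (sgn_of e * B i j) *\<^sub>R X e j r"
proof (induction r)
  case 0
  then show ?case by (rule H0_X0)
next
  case (Suc r)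
  have "commutator (H i 0) (X e j (Suc r))
    = (sgn_of e / B j j) *\<^sub>R commutator (ht j) (commutator (H i 0) (X e j r))"
    by (simp add: X_Suc[of e j r] commutator_linear commutator_exchange[OF H_ht])
  also have "\<dots> = (sgn_of e * B i j) *\<^sub>R X e j (Suc r)"
    by (simp add: Suc X_Suc[of e j r] commutator_linear mult.commute)
  finally show ?case .
qed

definition pair :: "'i \<Rightarrow> nat \<Rightarrow> nat \<Rightarrow> 'a" where
  "pair i r s = commutator (X Plus i r) (X Minus i s)"

lemma ht_X_X:
  "commutator (ht k) (commutator (X Plus i r) (X Minus j s)) =
    B k i *\<^sub>R commutator (X Plus i (Suc r)) (X Minus j s)
    - B k j *\<^sub>R commutator (X Plus i r) (X Minus j (Suc s))"
  by (simp add: commutator_jacobi[of "ht k"] ht_X commutator_linear)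

lemma ht_pair: "commutator (ht k) (pair i r s) = B k i *\<^sub>R (pair i (Suc r) s - pair i r (Suc s))"
  unfolding pair_def ht_X_X by (simp add: scaleR_diff_right)

lemma H0_pair: "commutator (H k 0) (pair i r s) = 0"
  by (simp add: pair_def commutator_jacobi[of "H k 0"] H0_X commutator_linear)

lemma X_X_distinct:
  assumes "i \<noteq> j"
  shows "commutator (X Plus i r) (X Minus j s) = 0"
proof (rule determinant_grid_zero[where Z = "\<lambda>r s. commutator (X Plus i r) (X Minus j s)"
      and a = "B i i" and b = "- B i j" and a' = "B j i" and b' = "- B j j"])
  show "commutator (X Plus i 0) (X Minus j 0) = 0"
    using assms X_X_low[of 0 0 i j] by simp
  show "B i i * - B j j - B j i * - B i j \<noteq> 0"
    using B_det[OF assms] B_sym[of i j] by simp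
  fix r s
  assume "commutator (X Plus i r) (X Minus j s) = 0"
  then show "B i i *\<^sub>R commutator (X Plus i (Suc r)) (X Minus j s)
      + - B i j *\<^sub>R commutator (X Plus i r) (X Minus j (Suc s)) = 0"
    "B j i *\<^sub>R commutator (X Plus i (Suc r)) (X Minus j s)
      + - B j j *\<^sub>R commutator (X Plus i r) (X Minus j (Suc s)) = 0"
    using ht_X_X[of i i r j s] ht_X_X[of j i r j s] by (simp_all add: commutator_linear)
qed

lemma drinfeld_X_X_distinct:
  assumes "i \<noteq> j"
  shows "drinfeld (sgn_of e * B i j / 2) (X e i) (X e j) r s = 0"
proof (rule determinant_grid_zero[where a = "sgn_of e * B i i" and b = "sgn_of e * B i j"
      and a' = "sgn_of e * B j i" and b' = "sgn_of e * B j j"])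
  show "drinfeld (sgn_of e * B i j / 2) (X e i) (X e j) 0 0 = 0"
    by (rule drinfeld_00)
  show "sgn_of e * B i i * (sgn_of e * B j j) - sgn_of e * B j i * (sgn_of e * B i j) \<noteq> 0"
    using B_det[OF assms] B_sym[of i j] by (simp add: mult_ac)
  fix r s
  assume "drinfeld (sgn_of e * B i j / 2) (X e i) (X e j) r s = 0"
  then show "(sgn_of e * B i i) *\<^sub>R drinfeld (sgn_of e * B i j / 2) (X e i) (X e j) (Suc r) s
      + (sgn_of e * B i j) *\<^sub>R drinfeld (sgn_of e * B i j / 2) (X e i) (X e j) r (Suc s) = 0"
    "(sgn_of e * B j i) *\<^sub>R drinfeld (sgn_of e * B i j / 2) (X e i) (X e j) (Suc r) s
      + (sgn_of e * B j j) *\<^sub>R drinfeld (sgn_of e * B i j / 2) (X e i) (X e j) r (Suc s) = 0"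
    using commutator_drinfeld_Suc[of "ht i" "X e i" _ "X e j", OF ht_X ht_X]
      commutator_drinfeld_Suc[of "ht j" "X e i" _ "X e j", OF ht_X ht_X]
    by (metis commutator_linear(8))+
qed

text \<open>
  The two candidates for \<open>H i r\<close>: the brackets of \<open>X Plus i r\<close> with \<open>X Minus i 0\<close> and of \<open>X Plus i 0\<close>
  with \<open>X Minus i r\<close>. Bracketing with the generator of opposite sign and degree zero turns
  relations for \<open>X e i\<close> into relations for the candidate belonging to \<open>e\<close>. That the two
  agree is part of what has to be proved.
\<close>
definition H_sgn :: "sign \<Rightarrow> 'i \<Rightarrow> nat \<Rightarrow> 'a" where
  "H_sgn e i r = sgn_of e *\<^sub>R commutator (X e i r) (X (opp e) i 0)"

lemma H_sgn_pair: "H_sgn Plus i r = pair i r 0" "H_sgn Minus i r = pair i 0 r"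
  using commutator_swap[of "X Minus i r"] by (simp_all add: H_sgn_def pair_def)

lemma opp_X: "commutator (X (opp e) i 0) (X e i r) = (- sgn_of e) *\<^sub>R H_sgn e i r"
  using commutator_swap[of "X (opp e) i 0"] by (simp add: H_sgn_def)

lemma opp_X_distinct: "i \<noteq> j \<Longrightarrow> commutator (X (opp e) i 0) (X e j r) = 0"
  using X_X_distinct[of j i r 0] X_X_distinct[of i j 0 r] commutator_swap[of "X Minus i 0"]
  by (cases e) simp_all

text \<open>
  Bracket the relation between \<open>X e i\<close> and \<open>X e j\<close> with the degree zero generator of opposite sign
  at \<open>i\<close>, which does not see \<open>X e j\<close>.
\<close>
lemma drinfeld_H_sgn_distinct:
  assumes "i \<noteq> j"
  shows "drinfeld (sgn_of e * B i j / 2) (H_sgn e i) (X e j) r s = 0"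
proof -
  have "commutator (X (opp e) i 0) (drinfeld (sgn_of e * B i j / 2) (X e i) (X e j) r s) = 0"
    using assms by (simp add: drinfeld_X_X_distinct commutator_linear)
  then show ?thesis
    unfolding commutator_drinfeld opp_X opp_X_distinct[OF assms] drinfeld_scale drinfeld_zero
    by simp
qed

lemma H_eq_pair: "H i r = pair i r 0"
proof (cases "r \<le> 1")
  case True
  then show ?thesis using X_X_low[of r 0 i i] by (simp add: pair_def)
next
  case False
  then obtain t where "r = Suc (Suc t)" by (metis One_nat_def le_SucE not0_implies_Suc not_less_eq_eq le0)
  then show ?thesis by (simp add: pair_def H_rec)
qed

section \<open>Power sums of the Cartan generators\<close>

text \<open>
  The sequence $1, h_{i0}, h_{i1}, \dots$. With this initial term the relation for the weight
  of a generator is the first instance of the relation between consecutive degrees.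
\<close>
definition Hseq :: "'i \<Rightarrow> nat \<Rightarrow> 'a" where
  "Hseq i n = (case n of 0 \<Rightarrow> 1 | Suc m \<Rightarrow> H i m)"

lemma Hseq_simps [simp]: "Hseq i 0 = 1" "Hseq i (Suc m) = H i m"
  by (simp_all add: Hseq_def)

definition power_sum :: "'i \<Rightarrow> nat \<Rightarrow> 'a" where
  "power_sum i n = newton (Hseq i) (Suc n)"

definition shift_coeff :: "'i \<Rightarrow> 'i \<Rightarrow> nat \<Rightarrow> nat \<Rightarrow> real" where
  "shift_coeff i j n k = power_sum_coeff (B i j / 2) n k"

lemma shift_coeff_top: "shift_coeff i j n n = real (Suc n) * B i j"
  by (simp add: shift_coeff_def power_sum_coeff_top)

lemma sum_shift_coeff_top:
  fixes f :: "nat \<Rightarrow> 'a"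
  assumes "\<And>k. k < n \<Longrightarrow> f k = 0"
  shows "(\<Sum>k\<le>n. shift_coeff i j n k *\<^sub>R f k) = (real (Suc n) * B i j) *\<^sub>R f n"
  using assms by (simp add: shift_coeff_top lessThan_Suc_atMost[symmetric])

text \<open>
  The relations between \<open>H i\<close> and \<open>X e j\<close> in the degrees that the power sums up to index \<open>N\<close>
  involve.
\<close>
definition H_acts :: "nat \<Rightarrow> 'i \<Rightarrow> 'i \<Rightarrow> bool" where
  "H_acts N i j \<longleftrightarrow> (\<forall>e. \<forall>m<N. \<forall>s. drinfeld (sgn_of e * B i j / 2) (H i) (X e j) m s = 0)"

lemma power_sum_X_if_acts:
  assumes "H_acts N i j" "n \<le> N"
  shows "commutator (power_sum i n) (X e j s) = (\<Sum>k\<le>n. (sgn_of e * shift_coeff i j n k) *\<^sub>R X e j (s + k))"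
proof -
  let ?c = "sgn_of e * B i j / 2"
  have "commutator (Hseq i (Suc m)) (X e j s) = Hseq i m * up ?c (X e j) s - up (- ?c) (X e j) s * Hseq i m"
    if "m < Suc N" for m s
  proof (cases m)
    case 0
    have "up ?c (X e j) s - up (- ?c) (X e j) s = (?c + ?c) *\<^sub>R X e j s"
      unfolding up_def by (simp only: scaleR_left_distrib) (simp add: algebra_simps)
    with 0 show ?thesis by (simp add: H0_X)
  next
    case (Suc l)
    with that assms(1) have "drinfeld ?c (H i) (X e j) l s = 0"
      by (simp add: H_acts_def)
    with Suc show ?thesis
      by (simp add: drinfeld_def up_def commutator_def algebra_simps)
  qed
  then have "intertwines (Suc N) (Hseq i) ?c (X e j)"
    by (simp add: intertwines_def)
  then have "commutator (power_sum i n) (X e j s) = (up ?c ^^ Suc n) (X e j) s - (up (- ?c) ^^ Suc n) (X e j) s"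
    unfolding power_sum_def using assms(2) by (intro commutator_newton) auto
  also have "\<dots> = (\<Sum>k\<le>n. power_sum_coeff ?c n k *\<^sub>R X e j (s + k))"
    by (rule up_funpow_diff)
  also have "power_sum_coeff ?c n = (\<lambda>k. sgn_of e * shift_coeff i j n k)"
    using power_sum_coeff_uminus[of "B i j / 2"] by (cases e) (simp_all add: shift_coeff_def fun_eq_iff)
  finally show ?thesis .
qed

text \<open>
  The coefficients for the two signs are opposite, so \<open>power_sum i n\<close> annihilates \<open>pair j r s\<close> as soon as
  the values of \<open>pair j\<close> depend on the total degree only.
\<close>
lemma power_sum_pair:
  assumes "H_acts N i j" "n \<le> N"
  shows "commutator (power_sum i n) (pair j r s) =
    (\<Sum>k\<le>n. shift_coeff i j n k *\<^sub>R (pair j (r + k) s - pair j r (s + k)))"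
  by (simp add: pair_def commutator_jacobi[of "power_sum i n"] power_sum_X_if_acts[OF assms] commutator_linear commutator_sum
      scaleR_diff_right sum_subtractf sum_negf)

section \<open>The brackets of positive with negative generators\<close>

text \<open>
  If this holds up to total degree \<open>N\<close>, both candidates for \<open>H i r\<close> agree for \<open>r \<le> N\<close>, and \<open>ht k\<close>
  commutes with \<open>H i r\<close> for \<open>r < N\<close>.
\<close>
definition flat :: "nat \<Rightarrow> bool" where
  "flat N \<longleftrightarrow> (\<forall>i r s. r + s \<le> N \<longrightarrow> pair i r s = H i (r + s))"

lemma flat_1: "flat 1"
  unfolding flat_def pair_def using X_X_low by auto

lemma flat_Suc:
  assumes "flat N" "\<And>i r s. r + s = N \<Longrightarrow> pair i (Suc r) s = pair i r (Suc s)"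
  shows "flat (Suc N)"
proof -
  have "pair i r s = H i (r + s)" if "r + s = Suc N" for i r s
    using that
  proof (induction s arbitrary: r)
    case 0
    then show ?case by (simp add: H_eq_pair)
  next
    case (Suc s)
    then have "pair i r (Suc s) = pair i (Suc r) s" using assms(2)[of r s] by simp
    with Suc show ?case by simp
  qed
  with assms(1) show ?thesis unfolding flat_def by (metis le_SucE)
qed

lemma flat_H_sgn: "flat N \<Longrightarrow> r \<le> N \<Longrightarrow> H i r = H_sgn e i r"
  by (cases e) (simp_all add: flat_def H_sgn_pair)

lemma flat_ht_H:
  assumes "flat N" "r < N"
  shows "commutator (ht k) (H i r) = 0"
proof -
  have "pair i (Suc r) 0 = pair i r (Suc 0)" using assms by (simp add: flat_def)
  then show ?thesis unfolding H_eq_pair[of i r] ht_pair by simp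
qed

lemma flat_H_acts:
  assumes "flat N" "i \<noteq> j"
  shows "H_acts N i j"
  unfolding H_acts_def
proof (intro allI impI)
  fix e m s
  assume "m < N"
  then have "drinfeld (sgn_of e * B i j / 2) (H i) (X e j) m s
      = drinfeld (sgn_of e * B i j / 2) (H_sgn e i) (X e j) m s"
    using flat_H_sgn[OF assms(1), of m i e] flat_H_sgn[OF assms(1), of "Suc m" i e]
    by (simp add: drinfeld_def)
  then show "drinfeld (sgn_of e * B i j / 2) (H i) (X e j) m s = 0"
    by (simp add: drinfeld_H_sgn_distinct[OF assms(2)])
qed

text \<open>
  On the next diagonal the values form an arithmetic progression: each difference is the bracket
  of \<open>ht i\<close> with \<open>H i N\<close>, up to the factor \<open>B i i\<close>.
\<close>
lemma flat_difference:
  assumes "flat N" "r + s = N"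
  shows "pair i (Suc r) s - pair i r (Suc s) = pair i (Suc N) 0 - pair i N 1"
proof -
  have "pair i r s = pair i N 0"
    using assms by (simp add: flat_def H_eq_pair[symmetric])
  then have "commutator (ht i) (pair i r s) = commutator (ht i) (pair i N 0)" by simp
  then show ?thesis unfolding ht_pair by simp
qed

text \<open>
  The bracket of \<open>power_sum j N\<close> with \<open>H i 1\<close> is evaluated twice. If \<open>H i 1\<close> is written as \<open>pair i 1 0\<close>,
  the leading shift moves it across \<open>N\<close> steps of the progression at \<open>i\<close>. Up to the square of \<open>H i 0\<close>,
  which contributes nothing, \<open>H i 1\<close> is \<open>ht i\<close>, and \<open>ht i\<close> sees only the leading term of the power
  sum, where it produces a single step of the progression at \<open>j\<close>.
\<close>
lemma flat_difference_neighbour: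
  assumes flat: "flat N" and ij: "i \<noteq> j" "B i j \<noteq> 0"
  shows "pair j (Suc N) 0 - pair j N 1 = - real N *\<^sub>R (pair i (Suc N) 0 - pair i N 1)"
proof -
  let ?D = "\<lambda>i. pair i (Suc N) 0 - pair i N 1"
  \<comment> \<open>Descend along the diagonal of total degree \<open>Suc N\<close> from \<open>(Suc t, N - t)\<close> to \<open>(1, N)\<close>.\<close>
  have ladder: "pair i (Suc t) (N - t) - pair i 1 N = real t *\<^sub>R ?D i" if "t \<le> N" for t
    using that
  proof (induction t)
    case 0
    then show ?case by simp
  next
    case (Suc t)
    then have "pair i (Suc (Suc t)) (N - Suc t) - pair i (Suc t) (N - t) = ?D i"
      using flat_difference[OF flat, of "Suc t" "N - Suc t" i] by (simp add: Suc_diff_Suc)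
    moreover have "pair i (Suc t) (N - t) - pair i 1 N = real t *\<^sub>R ?D i"
      using Suc.prems by (intro Suc.IH) simp
    ultimately have "pair i (Suc (Suc t)) (N - Suc t) - pair i 1 N = ?D i + real t *\<^sub>R ?D i"
      by (rule diff_chain)
    then show ?case by (simp only: of_nat_Suc scaleR_left_distrib scaleR_one)
  qed
  have acts: "H_acts N j i" using ij by (intro flat_H_acts[OF flat]) simp
  have "commutator (power_sum j N) (pair i 1 0)
    = (\<Sum>k\<le>N. shift_coeff j i N k *\<^sub>R (pair i (1 + k) 0 - pair i 1 (0 + k)))"
    by (rule power_sum_pair[OF acts order_refl])
  also have "\<dots> = (real (Suc N) * B j i) *\<^sub>R (pair i (1 + N) 0 - pair i 1 (0 + N))"
    using flat by (intro sum_shift_coeff_top) (simp add: flat_def)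
  also have "\<dots> = (real (Suc N) * B j i) *\<^sub>R real N *\<^sub>R ?D i"
    using ladder[of N] by simp
  finally have 1: "commutator (power_sum j N) (H i 1) = (real (Suc N) * B j i) *\<^sub>R real N *\<^sub>R ?D i"
    by (simp add: H_eq_pair)
  have H0: "commutator (H i 0) (power_sum j N) = 0"
    unfolding power_sum_def
  proof (rule commutator_newton_zero)
    fix m
    show "commutator (H i 0) (Hseq j m) = 0"
      by (cases m) (simp_all add: H_eq_pair[of j] H0_pair, simp add: commutator_def)
  qed
  have "commutator (ht i) (power_sum j N) = real (Suc N) *\<^sub>R commutator (ht i) (Hseq j (Suc N))"
    unfolding power_sum_def
  proof (rule commutator_newton_top)
    fix m
    assume "m < Suc N"
    then show "commutator (ht i) (Hseq j m) = 0"
      by (cases m) (simp_all add: flat_ht_H[OF flat], simp add: commutator_def)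
  qed
  also have "\<dots> = (real (Suc N) * B i j) *\<^sub>R ?D j"
    by (simp add: H_eq_pair[of j] ht_pair)
  finally have 2: "commutator (ht i) (power_sum j N) = (real (Suc N) * B i j) *\<^sub>R ?D j" .
  have "commutator (ht i) (power_sum j N) = commutator (H i 1) (power_sum j N)"
    by (simp add: ht_def commutator_linear commutator_mult_right H0)
  then have "(real (Suc N) * B i j) *\<^sub>R ?D j = - ((real (Suc N) * B j i) *\<^sub>R real N *\<^sub>R ?D i)"
    using 1 2 commutator_swap[of "H i 1"] by simp
  also have "\<dots> = (real (Suc N) * B i j) *\<^sub>R (- real N *\<^sub>R ?D i)"
    by (simp add: B_sym[of i j])
  finally show ?thesis
    using ij(2) by (simp only: scaleR_cancel_left) simp
qed

text \<open>
  Two neighbours exchange their differences with factor \<open>- N\<close>, so the differences vanish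
  unless \<open>N * N = 1\<close>. The step from total degree one to two has to come from the assumption
  that \<open>ht i\<close> commutes with \<open>H i 1\<close>.
\<close>
lemma flat_all: "flat N"
proof (induction N)
  case 0
  then show ?case using flat_1 by (simp add: flat_def)
next
  case (Suc N)
  consider "N = 0" | "N = 1" | "N \<ge> 2" by linarith
  then show ?case
  proof cases
    case 1
    then show ?thesis using flat_1 by simp
  next
    case 2
    have "pair i 2 0 = pair i 1 1" for i
      using ht_H_low[of 1 i i] ht_pair[of i i 1 0] by (simp add: H_eq_pair numeral_2_eq_2)
    then have "pair i (Suc r) s = pair i r (Suc s)" if "r + s = N" for i r s
      using flat_difference[OF Suc that, of i] 2 by (simp add: numeral_2_eq_2)
    then show ?thesis using flat_Suc[OF Suc] by blast
  next
    case 3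
    have "pair i (Suc N) 0 - pair i N 1 = 0" for i
    proof -
      let ?D = "\<lambda>i. pair i (Suc N) 0 - pair i N 1"
      obtain j where j: "j \<noteq> i" "B i j \<noteq> 0" using neighbour by blast
      have "?D j = - real N *\<^sub>R ?D i" "?D i = - real N *\<^sub>R ?D j"
        using flat_difference_neighbour[OF Suc, of i j] flat_difference_neighbour[OF Suc, of j i]
          j B_sym[of i j] by simp_all
      moreover have "real N * real N \<noteq> 1"
      proof -
        have "N * N \<noteq> 1" using 3 by simp
        then show ?thesis by (metis of_nat_eq_1_iff of_nat_mult)
      qed
      ultimately show ?thesis using swap_scale_zero by blast
    qed
    then have "pair i (Suc r) s = pair i r (Suc s)" if "r + s = N" for i r s
      using flat_difference[OF Suc that, of i] by simp
    then show ?thesis using flat_Suc[OF Suc] by blast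
  qed
qed

lemma pair_eq_H: "pair i r s = H i (r + s)"
  using flat_all[of "r + s"] by (simp add: flat_def)

lemma X_X: "commutator (X Plus i r) (X Minus j s) = (if i = j then H i (r + s) else 0)"
  using pair_eq_H[of i r s] by (cases "i = j") (simp_all add: pair_def X_X_distinct)

lemma ht_H: "commutator (ht k) (H i r) = 0"
  using flat_ht_H[OF flat_all, of r "Suc r"] by simp

end

section \<open>Serre relations in all degrees\<close>

definition sym_ad :: "nat \<Rightarrow> (nat \<Rightarrow> 'a::real_algebra) \<Rightarrow> (nat \<Rightarrow> 'a) \<Rightarrow> (nat \<Rightarrow> nat) \<Rightarrow> nat \<Rightarrow> 'a" where
  "sym_ad b x z r s =
    (\<Sum>\<sigma> | \<sigma> permutes {..<b}. foldr (\<lambda>k. commutator (x (r (\<sigma> k)))) [0..<b] (z s))"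

lemma sym_ad_permute:
  assumes "\<tau> permutes {..<b}"
  shows "sym_ad b x z (r \<circ> \<tau>) s = sym_ad b x z r s"
  using setum_permutations_compose_left[OF assms, of "\<lambda>\<sigma>. foldr (\<lambda>k. commutator (x (r (\<sigma> k)))) [0..<b] (z s)"]
  by (simp add: sym_ad_def)

lemma commutator_foldr:
  fixes x z :: "nat \<Rightarrow> 'a::real_algebra"
  assumes x: "\<And>r. commutator g (x r) = (\<Sum>k\<le>n. \<phi> k *\<^sub>R x (r + k))"
    and z: "\<And>s. commutator g (z s) = (\<Sum>k\<le>n. \<psi> k *\<^sub>R z (s + k))"
    and "distinct ms"
  shows "commutator g (foldr (\<lambda>m. commutator (x (t m))) ms (z s)) =
    (\<Sum>k\<le>n. \<phi> k *\<^sub>R (\<Sum>l\<in>set ms. foldr (\<lambda>m. commutator (x ((t(l := t l + k)) m))) ms (z s)))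
    + (\<Sum>k\<le>n. \<psi> k *\<^sub>R foldr (\<lambda>m. commutator (x (t m))) ms (z (s + k)))"
  using assms(3)
proof (induction ms)
  case Nil
  then show ?case by (simp add: z)
next
  case (Cons a ms)
  let ?F = "\<lambda>t s. foldr (\<lambda>m. commutator (x (t m))) ms (z s)"
  have "?F (t(a := t a + k)) s = ?F t s" for k
    using Cons.prems by (intro foldr_cong) auto
  moreover have "(\<Sum>l\<in>set ms. commutator (x ((t(l := t l + k)) a)) (?F (t(l := t l + k)) s))
      = (\<Sum>l\<in>set ms. commutator (x (t a)) (?F (t(l := t l + k)) s))" for k
    using Cons.prems by (intro sum.cong) auto
  ultimately show ?case
    using Cons by (simp add: commutator_jacobi[of g] x commutator_linear commutator_sum
        scaleR_add_right sum.distrib scaleR_sum_right del: fun_upd_apply) (simp add: algebra_simps)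
qed

text \<open>
  A derivation acts on the iterated commutator by the Leibniz rule. After symmetrization the sum over
  the positions of the iterated commutator becomes a sum over the entries of the degree vector
  \<open>r\<close>.
\<close>
lemma commutator_sym_ad:
  fixes x z :: "nat \<Rightarrow> 'a::real_algebra"
  assumes x: "\<And>r. commutator g (x r) = (\<Sum>k\<le>n. \<phi> k *\<^sub>R x (r + k))"
    and z: "\<And>s. commutator g (z s) = (\<Sum>k\<le>n. \<psi> k *\<^sub>R z (s + k))"
  shows "commutator g (sym_ad b x z r s) =
    (\<Sum>k\<le>n. \<phi> k *\<^sub>R (\<Sum>l<b. sym_ad b x z (r(l := r l + k)) s) + \<psi> k *\<^sub>R sym_ad b x z r (s + k))"
proof -
  let ?P = "{\<sigma>. \<sigma> permutes {..<b}}"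
  let ?F = "\<lambda>t s. foldr (\<lambda>m. commutator (x (t m))) [0..<b] (z s)"
  have shift: "(\<Sum>l<b. ?F ((r \<circ> \<sigma>)(l := (r \<circ> \<sigma>) l + k)) s) = (\<Sum>l<b. ?F (r(l := r l + k) \<circ> \<sigma>) s)"
    if "\<sigma> permutes {..<b}" for \<sigma> k
  proof -
    have "(r \<circ> \<sigma>)(l := (r \<circ> \<sigma>) l + k) = r(\<sigma> l := r (\<sigma> l) + k) \<circ> \<sigma>" for l
      using permutes_inj[OF that] by (auto simp: fun_eq_iff inj_eq)
    then show ?thesis
      using sum.permute[OF that, of "\<lambda>l. ?F (r(l := r l + k) \<circ> \<sigma>) s"] by (simp only: comp_def)
  qed
  have "commutator g (sym_ad b x z r s) = (\<Sum>\<sigma>\<in>?P. commutator g (?F (r \<circ> \<sigma>) s))"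
    by (simp add: sym_ad_def commutator_sum)
  also have "\<dots> = (\<Sum>\<sigma>\<in>?P. (\<Sum>k\<le>n. \<phi> k *\<^sub>R (\<Sum>l<b. ?F (r(l := r l + k) \<circ> \<sigma>) s))
      + (\<Sum>k\<le>n. \<psi> k *\<^sub>R ?F (r \<circ> \<sigma>) (s + k)))"
  proof (rule sum.cong)
    fix \<sigma>
    assume "\<sigma> \<in> ?P"
    then have "\<sigma> permutes {..<b}" by simp
    then show "commutator g (?F (r \<circ> \<sigma>) s) = (\<Sum>k\<le>n. \<phi> k *\<^sub>R (\<Sum>l<b. ?F (r(l := r l + k) \<circ> \<sigma>) s))
      + (\<Sum>k\<le>n. \<psi> k *\<^sub>R ?F (r \<circ> \<sigma>) (s + k))"
      unfolding commutator_foldr[OF x z distinct_upt] set_upt atLeast0LessThan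
      by (simp only: shift)
  qed simp
  also have "\<dots> = (\<Sum>k\<le>n. \<phi> k *\<^sub>R (\<Sum>l<b. \<Sum>\<sigma>\<in>?P. ?F (r(l := r l + k) \<circ> \<sigma>) s))
      + (\<Sum>k\<le>n. \<psi> k *\<^sub>R (\<Sum>\<sigma>\<in>?P. ?F (r \<circ> \<sigma>) (s + k)))"
    unfolding sum.distrib scaleR_sum_right
    by (simp only: sum.swap[of _ "{..n}" ?P] sum.swap[of _ "{..<b}" ?P])
  finally show ?thesis
    by (simp only: sym_ad_def sum.distrib comp_apply)
qed

text \<open>
  By induction on the total degree. For each \<open>n\<close> the derivations \<open>g n\<close> and \<open>g' n\<close> shift by \<open>n\<close>, up to
  lower terms that vanish by induction. As their leading coefficients are independent, raising \<open>s\<close>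
  by \<open>n\<close> gives zero, and so does raising \<open>r\<close> by \<open>n\<close> and summing over the \<open>b\<close> places. The first
  statement covers all cases with \<open>s > 0\<close>. For \<open>s = 0\<close> induct on the number of
  nonzero entries of \<open>r\<close>: remove one entry \<open>n\<close> and apply the second statement. Where \<open>n\<close> is added to a
  nonzero entry, the number of nonzero entries has dropped; where it is put in place of a zero, the
  result is a permutation of \<open>r\<close>, with the same symmetrized commutator.
\<close>
lemma sym_ad_zero:
  fixes x z :: "nat \<Rightarrow> 'a::real_algebra"
  assumes g: "\<And>n r. n \<ge> 1 \<Longrightarrow> commutator (g n) (x r) = (\<Sum>k\<le>n. \<phi> n k *\<^sub>R x (r + k))"
      "\<And>n s. n \<ge> 1 \<Longrightarrow> commutator (g n) (z s) = (\<Sum>k\<le>n. \<psi> n k *\<^sub>R z (s + k))"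
    and g': "\<And>n r. n \<ge> 1 \<Longrightarrow> commutator (g' n) (x r) = (\<Sum>k\<le>n. \<phi>' n k *\<^sub>R x (r + k))"
      "\<And>n s. n \<ge> 1 \<Longrightarrow> commutator (g' n) (z s) = (\<Sum>k\<le>n. \<psi>' n k *\<^sub>R z (s + k))"
    and det: "\<And>n. n \<ge> 1 \<Longrightarrow> \<phi> n n * \<psi>' n n - \<phi>' n n * \<psi> n n \<noteq> 0"
    and zero: "sym_ad b x z (\<lambda>_. 0) 0 = 0"
  shows "sym_ad b x z r s = 0"
proof (induction "(\<Sum>l<b. r l) + s" arbitrary: r s rule: less_induct)
  case (less r s)
  let ?S = "sym_ad b x z"
  let ?N = "(\<Sum>l<b. r l) + s"
  have total: "(\<Sum>l<b. (u(m := u m + k)) l) = (\<Sum>l<b. u l) + k" if "m < b" for u :: "nat \<Rightarrow> nat" and m k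
    using that by (simp add: sum.remove[of "{..<b}" m])
  have step: "(\<Sum>l<b. ?S (u(l := u l + n)) v) = 0 \<and> ?S u (v + n) = 0"
    if "(\<Sum>l<b. u l) + v + n = ?N" "n \<ge> 1" for u v n
  proof -
    have low: "(\<Sum>l<b. ?S (u(l := u l + k)) v) = 0" "?S u (v + k) = 0" if "k < n" for k
    proof -
      show "(\<Sum>l<b. ?S (u(l := u l + k)) v) = 0"
        using \<open>k < n\<close> \<open>(\<Sum>l<b. u l) + v + n = ?N\<close>
        by (intro sum.neutral ballI less.hyps) (simp add: total del: fun_upd_apply)
      show "?S u (v + k) = 0"
        using \<open>k < n\<close> \<open>(\<Sum>l<b. u l) + v + n = ?N\<close> by (intro less.hyps) simp
    qed
    have "?S u v = 0" using low(2)[of 0] \<open>n \<ge> 1\<close> by simp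
    then have "(\<Sum>k\<le>n. \<phi> n k *\<^sub>R (\<Sum>l<b. ?S (u(l := u l + k)) v) + \<psi> n k *\<^sub>R ?S u (v + k)) = 0"
      "(\<Sum>k\<le>n. \<phi>' n k *\<^sub>R (\<Sum>l<b. ?S (u(l := u l + k)) v) + \<psi>' n k *\<^sub>R ?S u (v + k)) = 0"
      using commutator_sym_ad[of "g n" x "\<phi> n" n z "\<psi> n" b u v, OF g]
        commutator_sym_ad[of "g' n" x "\<phi>' n" n z "\<psi>' n" b u v, OF g'] \<open>n \<ge> 1\<close>
      by (simp_all only: commutator_linear)
    then have "\<phi> n n *\<^sub>R (\<Sum>l<b. ?S (u(l := u l + n)) v) + \<psi> n n *\<^sub>R ?S u (v + n) = 0"
      "\<phi>' n n *\<^sub>R (\<Sum>l<b. ?S (u(l := u l + n)) v) + \<psi>' n n *\<^sub>R ?S u (v + n) = 0"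
      by (simp_all add: lessThan_Suc_atMost[symmetric] low del: fun_upd_apply)
    with det[OF \<open>n \<ge> 1\<close>] show ?thesis
      using determinant_zero by blast
  qed
  have s0: "?S u 0 = 0" if "(\<Sum>l<b. u l) = ?N" and N: "?N \<noteq> 0" for u
    using that(1)
  proof (induction "card {l. l < b \<and> u l \<noteq> 0}" arbitrary: u rule: less_induct)
    case (less u)
    obtain m where m: "m < b" "u m \<noteq> 0"
      using less.prems N by (metis lessThan_iff sum.neutral)
    define u' where "u' = u(m := 0)"
    let ?Z = "{l. l < b \<and> u' l = 0}"
    have u: "u = u'(m := u' m + u m)" by (auto simp: u'_def)
    have "(\<Sum>l<b. u' l) + 0 + u m = ?N"
      using total[OF m(1), of u' "u m"] less.prems u by simp
    then have "0 = (\<Sum>l<b. ?S (u'(l := u' l + u m)) 0)"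
      using step[of u' 0 "u m"] m(2) by simp
    also have "\<dots> = (\<Sum>l\<in>?Z. ?S (u'(l := u' l + u m)) 0)"
    proof (rule sum.mono_neutral_right)
      show "\<forall>l\<in>{..<b} - ?Z. ?S (u'(l := u' l + u m)) 0 = 0"
      proof
        fix l
        assume "l \<in> {..<b} - ?Z"
        then have l: "l < b" "u' l \<noteq> 0" by auto
        then have "l \<noteq> m" by (auto simp: u'_def)
        have "{k. k < b \<and> (u'(l := u' l + u m)) k \<noteq> 0} \<subset> {k. k < b \<and> u k \<noteq> 0}"
          using l m \<open>l \<noteq> m\<close> by (auto simp: u'_def split: if_splits)
        then have "card {k. k < b \<and> (u'(l := u' l + u m)) k \<noteq> 0} < card {k. k < b \<and> u k \<noteq> 0}"
          by (intro psubset_card_mono) auto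
        moreover have "(\<Sum>k<b. (u'(l := u' l + u m)) k) = ?N"
          using total[OF l(1), of u' "u m"] \<open>(\<Sum>l<b. u' l) + 0 + u m = ?N\<close> by simp
        ultimately show "?S (u'(l := u' l + u m)) 0 = 0"
          by (rule less.hyps)
      qed
    qed auto
    also have "\<dots> = (\<Sum>l\<in>?Z. ?S u 0)"
    proof (rule sum.cong)
      fix l
      assume "l \<in> ?Z"
      then have "Transposition.transpose l m permutes {..<b}"
        using m by (auto intro: permutes_swap_id)
      moreover have "u'(l := u' l + u m) = u \<circ> Transposition.transpose l m"
        using \<open>l \<in> ?Z\<close> by (auto simp: u'_def transpose_def fun_eq_iff)
      ultimately show "?S (u'(l := u' l + u m)) 0 = ?S u 0"
        by (metis sym_ad_permute)
    qed simp
    also have "\<dots> = real (card ?Z) *\<^sub>R ?S u 0"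
      by (simp add: sum_constant_scaleR)
    finally have "real (card ?Z) *\<^sub>R ?S u 0 = 0" ..
    moreover have "m \<in> ?Z" using m by (simp add: u'_def)
    then have "card ?Z \<noteq> 0" by (auto simp: card_eq_0_iff)
    ultimately show ?case by simp
  qed
  show ?case
  proof (cases "?N = 0")
    case True
    have "sym_ad b x z r s = sym_ad b x z (\<lambda>_. 0) 0"
      unfolding sym_ad_def using True
      by (intro sum.cong foldr_cong) (auto simp: permutes_in_image[of _ "{..<b}", simplified])
    with zero show ?thesis by simp
  next
    case False
    show ?thesis
    proof (cases "s = 0")
      case True
      with s0[OF _ False] show ?thesis by simp
    next
      case s: False
      with step[of r 0 s] show ?thesis by simp
    qed
  qed
qed

section \<open>The remaining relations of the Yangian\<close>

context reduced_yangian_elements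
begin

lemma drinfeld_H_X_distinct: "i \<noteq> j \<Longrightarrow> drinfeld (sgn_of e * B i j / 2) (H i) (X e j) r s = 0"
  using flat_H_acts[OF flat_all, of i j "Suc r"] by (simp add: H_acts_def)

lemma H_eq_H_sgn: "H i = H_sgn e i"
  using flat_H_sgn[OF flat_all] by blast

lemma power_sum_X_distinct:
  assumes "j \<noteq> i"
  shows "commutator (power_sum j n) (X e i s) = (\<Sum>k\<le>n. (sgn_of e * shift_coeff j i n k) *\<^sub>R X e i (s + k))"
  by (rule power_sum_X_if_acts[OF flat_H_acts[OF flat_all assms] order_refl])

text \<open>
  The power sums of a neighbour act on both sequences \<open>X e i\<close> with the same coefficients. Modulo
  lower total degree, shifting the first index by \<open>n\<close> is thus the negative of shifting the
  second. Starting from degrees \<open>(0, 0)\<close> this contradicts the symmetry of \<open>drinfeld\<close> unless the defect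
  vanishes on the axes, and from the axes it vanishes everywhere.
\<close>
lemma drinfeld_X_X_same: "drinfeld (sgn_of e * B i i / 2) (X e i) (X e i) r s = 0"
proof (induction "r + s" arbitrary: r s rule: less_induct)
  case (less r s)
  let ?Z = "drinfeld (sgn_of e * B i i / 2) (X e i) (X e i)"
  obtain j where j: "j \<noteq> i" "B j i \<noteq> 0" using neighbour[of i] B_sym by metis
  have step: "?Z (u + n) v = - ?Z u (v + n)" if "u + v + n = r + s" "n \<ge> 1" for u v n
  proof -
    have "?Z u v = 0" using that by (intro less) simp
    then have "0 = sgn_of e *\<^sub>R commutator (power_sum j n) (?Z u v)" by (simp add: commutator_linear)
    also have "\<dots> = (\<Sum>k\<le>n. shift_coeff j i n k *\<^sub>R (?Z (u + k) v + ?Z u (v + k)))"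
      unfolding commutator_drinfeld_shifts[OF power_sum_X_distinct[OF j(1)] power_sum_X_distinct[OF j(1)]]
      by (simp add: scaleR_add_right scaleR_sum_right sum.distrib)
    also have "\<dots> = (real (Suc n) * B j i) *\<^sub>R (?Z (u + n) v + ?Z u (v + n))"
      using that by (intro sum_shift_coeff_top) (simp add: less)
    finally show ?thesis using j by (simp add: eq_neg_iff_add_eq_0)
  qed
  have axis: "?Z n 0 = 0" if "n = r + s" for n
  proof (cases "n = 0")
    case True
    then show ?thesis by (simp add: drinfeld_00)
  next
    case False
    then have "?Z n 0 = - ?Z 0 n" using step[of 0 0 n] that by (simp only: add_0)
    then have "?Z n 0 = - ?Z n 0" by (simp only: drinfeld_swap[of _ _ _ 0 n])
    then show ?thesis by (simp add: equation_minus_iff eq_neg_iff_add_eq_0 scaleR_2[symmetric])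
  qed
  show ?case
  proof (cases "s = 0")
    case True
    then show ?thesis using axis by simp
  next
    case False
    then show ?thesis using step[of r 0 s] axis[of "r + s"] by simp
  qed
qed

lemma drinfeld_X_X: "drinfeld (sgn_of e * B i j / 2) (X e i) (X e j) r s = 0"
  by (cases "i = j") (simp_all add: drinfeld_X_X_same drinfeld_X_X_distinct)

text \<open>This only restates \<open>ht_X\<close>, with \<open>ht i\<close> written out.\<close>
lemma drinfeld_H0_X: "drinfeld (sgn_of e * B i j / 2) (H i) (X e j) 0 s = 0"
proof -
  have "commutator (H i 1) (X e j s)
    = commutator (ht i) (X e j s) + (1/2) *\<^sub>R commutator (H i 0 * H i 0) (X e j s)"
    by (simp add: ht_def commutator_linear)
  then show ?thesis
    by (simp add: drinfeld_def commutator_mult_right ht_X H0_X scaleR_add_right)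
qed

text \<open>
  For \<open>i = j\<close> the degree zero generator of opposite sign acts on both factors of the
  relation between \<open>X e i\<close> and \<open>X e i\<close>. The result is the sum of the defects in degrees \<open>(r, s)\<close> and
  \<open>(s, r)\<close>. One of them vanishes if \<open>s = 0\<close>; then \<open>ht i\<close>, which commutes with \<open>H i\<close>, raises \<open>s\<close> alone.
\<close>
lemma drinfeld_H_X: "drinfeld (sgn_of e * B i j / 2) (H i) (X e j) r s = 0"
proof (cases "i = j")
  case False
  then show ?thesis by (rule drinfeld_H_X_distinct)
next
  case True
  let ?Z = "drinfeld (sgn_of e * B i i / 2) (H i) (X e i)"
  have "commutator (X (opp e) i 0) (drinfeld (sgn_of e * B i i / 2) (X e i) (X e i) r s) = 0" for r s
    by (simp add: drinfeld_X_X commutator_linear)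
  then have "sgn_of e *\<^sub>R (?Z r s + ?Z s r) = 0" for r s
    unfolding commutator_drinfeld opp_X drinfeld_scale H_eq_H_sgn[symmetric]
      drinfeld_swap[of _ "X e i" "\<lambda>s. (- sgn_of e) *\<^sub>R H i s"]
    by (simp add: scaleR_add_right add_eq_0_iff)
  then have Z_axis: "?Z r 0 = 0" for r
    using drinfeld_H0_X[of e i i r] by (metis add.right_neutral scaleR_eq_0_iff sgn_of_nonzero)
  have "?Z r s = 0" for s
  proof (induction s)
    case 0
    show ?case by (rule Z_axis)
  next
    case (Suc s)
    have "commutator (ht i) (?Z r s) = (sgn_of e * B i i) *\<^sub>R ?Z r (Suc s)"
      using commutator_drinfeld_Suc[of "ht i" "H i" 0 "X e i", OF _ ht_X] by (simp add: ht_H)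
    with Suc show ?case by (simp add: commutator_linear)
  qed
  with True show ?thesis by simp
qed

lemma power_sum_X: "commutator (power_sum i n) (X e j s) = (\<Sum>k\<le>n. (sgn_of e * shift_coeff i j n k) *\<^sub>R X e j (s + k))"
  by (rule power_sum_X_if_acts[of n]) (simp_all add: H_acts_def drinfeld_H_X)

lemma power_sum_H: "commutator (power_sum i n) (H j s) = 0"
  using power_sum_pair[of n i j n s 0] by (simp add: H_acts_def drinfeld_H_X pair_eq_H)

text \<open>
  The power sums commute with all \<open>H j s\<close>, and by Newton's recursion the \<open>H i r\<close> are polynomials in
  them.
\<close>
lemma H_H_all: "commutator (H i r) (H j s) = 0"
proof -
  have "commutator (H j s) (Hseq i n) = 0" for n
  proof (induction n rule: less_induct)
    case (less n)
    show ?case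
    proof (cases n)
      case 0
      then show ?thesis by (simp add: commutator_def)
    next
      case (Suc m)
      have "commutator (H j s) (newton (Hseq i) n) = real n *\<^sub>R commutator (H j s) (Hseq i n)"
        by (rule commutator_newton_top) (rule less)
      moreover have "commutator (H j s) (newton (Hseq i) n) = 0"
        using power_sum_H[of i m j s] Suc commutator_swap[of "H j s"] by (simp add: power_sum_def)
      ultimately show ?thesis using Suc by simp
    qed
  qed
  from this[of "Suc r"] show ?thesis using commutator_swap[of "H i r"] by simp
qed

lemma serre_all:
  assumes "i \<noteq> j" "b = nat (1 - A i j)"
  shows "sym_ad b (X e i) (X e j) r s = 0"
proof (rule sym_ad_zero)
  show "commutator (power_sum i n) (X e i r) = (\<Sum>k\<le>n. (sgn_of e * shift_coeff i i n k) *\<^sub>R X e i (r + k))"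
    "commutator (power_sum i n) (X e j r) = (\<Sum>k\<le>n. (sgn_of e * shift_coeff i j n k) *\<^sub>R X e j (r + k))"
    "commutator (power_sum j n) (X e i r) = (\<Sum>k\<le>n. (sgn_of e * shift_coeff j i n k) *\<^sub>R X e i (r + k))"
    "commutator (power_sum j n) (X e j r) = (\<Sum>k\<le>n. (sgn_of e * shift_coeff j j n k) *\<^sub>R X e j (r + k))" for n r
    by (rule power_sum_X)+
  show "sgn_of e * shift_coeff i i n n * (sgn_of e * shift_coeff j j n n)
    - sgn_of e * shift_coeff j i n n * (sgn_of e * shift_coeff i j n n) \<noteq> 0" for n
  proof -
    have "sgn_of e * shift_coeff i i n n * (sgn_of e * shift_coeff j j n n)
      - sgn_of e * shift_coeff j i n n * (sgn_of e * shift_coeff i j n n)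
      = (sgn_of e * sgn_of e) * (real (Suc n) * real (Suc n)) * (B i i * B j j - B i j * B i j)"
      unfolding shift_coeff_top B_sym[of j i] by (simp only: algebra_simps)
    then show ?thesis using B_det[OF assms(1)] by simp
  qed
  have "foldr (\<lambda>k. commutator (X e i 0)) ks y = (commutator (X e i 0) ^^ length ks) y" for ks :: "nat list" and y
    by (induction ks) simp_all
  then show "sym_ad b (X e i) (X e j) (\<lambda>_. 0) 0 = 0"
    using serre_0[OF assms(1), of e] by (simp add: sym_ad_def assms(2))
qed

end

section \<open>Free algebras and their ideals\<close>

lemma const_simps:
  "const 1 = 1" "const 0 = 0" "const (a + b) = const a + const b" "const (a * b) = const a * const b"
  by (simp_all add: const_def single_add mult_single)

lemma nc_poly_induct [case_names single add]:
  fixes p :: "'g nc_poly"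
  assumes single: "\<And>w c. P (Poly_Mapping.single (Word w) c)"
    and add: "\<And>p q. P p \<Longrightarrow> P q \<Longrightarrow> P (p + q)"
  shows "P p"
proof (induction p rule: update_induct)
  case const
  show ?case using single[of "[]" 0] by simp
next
  case (update p u c)
  have "Poly_Mapping.update u c p = p + Poly_Mapping.single u c"
    using update(1)
    by (intro poly_mapping_eqI) (auto simp: lookup_update lookup_add lookup_single in_keys_iff when_def)
  then show ?case
    using add[OF update(3) single[of "letters u" c]] by simp
qed

lemma const_central: "const c * p = p * const c"
  by (induction p rule: nc_poly_induct) (simp_all add: const_def mult_single algebra_simps)

locale ring_map =
  fixes h :: "'a::ring \<Rightarrow> 'b::ring"
  assumes add: "h (x + y) = h x + h y" and mult: "h (x * y) = h x * h y"
begin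

lemma zero: "h 0 = 0"
  using add[of 0 0] by simp

lemma uminus: "h (- x) = - h x"
  using add[of x "- x"] by (simp add: zero eq_neg_iff_add_eq_0 add.commute)

lemma diff: "h (x - y) = h x - h y"
  using add[of x "- y"] by (simp add: uminus)

lemma sum: "h (\<Sum>x\<in>S. f x) = (\<Sum>x\<in>S. h (f x))"
  by (induction S rule: infinite_finite_induct) (simp_all add: zero add)

lemma commutator: "h (commutator x y) = commutator (h x) (h y)"
  by (simp add: commutator_def diff mult)

lemma commutator_funpow: "h ((commutator x ^^ n) y) = (commutator (h x) ^^ n) (h y)"
  by (induction n) (simp_all add: commutator)

lemma foldr_commutator: "h (foldr (\<lambda>k. commutator (f k)) ks y) = foldr (\<lambda>k. commutator (h (f k))) ks (h y)"
  by (induction ks) (simp_all add: commutator)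

lemmas simps = zero add mult diff sum commutator commutator_funpow foldr_commutator

end

definition substitute :: "('g \<Rightarrow> 'h nc_poly) \<Rightarrow> 'g nc_poly \<Rightarrow> 'h nc_poly" where
  "substitute f p = (\<Sum>w\<in>Poly_Mapping.keys p. const (Poly_Mapping.lookup p w) * prod_list (map f (letters w)))"

lemma substitute_superset:
  assumes "finite S" "Poly_Mapping.keys p \<subseteq> S"
  shows "substitute f p = (\<Sum>w\<in>S. const (Poly_Mapping.lookup p w) * prod_list (map f (letters w)))"
  unfolding substitute_def using assms
  by (intro sum.mono_neutral_left) (auto simp: in_keys_iff const_simps)

lemma substitute_single:
  "substitute f (Poly_Mapping.single w c) = const c * prod_list (map f (letters w))"
  using substitute_superset[of "{w}" "Poly_Mapping.single w c" f] by simp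

lemma substitute_add: "substitute f (p + q) = substitute f p + substitute f q"
proof -
  let ?S = "Poly_Mapping.keys p \<union> Poly_Mapping.keys q"
  have fin: "finite ?S" by simp
  show ?thesis
    using substitute_superset[OF fin, of p f] substitute_superset[OF fin, of q f]
      substitute_superset[OF fin, of "p + q" f] Poly_Mapping.keys_add[of p q]
    by (simp add: lookup_add const_simps distrib_right sum.distrib)
qed

lemma letters_zero: "letters 0 = []"
  by (simp add: zero_free_monoid_def)

lemma substitute_mult:
  fixes f :: "'g \<Rightarrow> 'h nc_poly"
  shows "substitute f (p * q) = substitute f p * substitute f q"
proof (induction p rule: nc_poly_induct)
  case (single v c)
  show ?case
  proof (induction q rule: nc_poly_induct)
    case (single w d)
    have "const c * x * (const d * y) = const (c * d) * (x * y)" for x y :: "'h nc_poly"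
      by (simp add: const_simps mult.assoc) (metis const_central mult.assoc)
    then show ?case
      by (simp add: mult_single substitute_single plus_free_monoid_def)
  qed (simp add: distrib_left substitute_add)
qed (simp add: distrib_right substitute_add)

lemma substitute_one: "substitute f 1 = 1"
  using substitute_single[of f 0 1] by (simp add: const_simps letters_zero)

lemma substitute_const: "substitute f (const c * p) = const c * substitute f p"
  using substitute_single[of f 0 c] by (simp add: substitute_mult const_def letters_zero)

lemma substitute_gen: "substitute f (gen g) = f g"
  by (simp add: gen_def substitute_single const_simps)

lemma ring_map_substitute: "ring_map (substitute f)"
  by standard (simp_all add: substitute_add substitute_mult)

lemma prod_list_gen: "prod_list (map gen ws) = Poly_Mapping.single (Word ws) 1"
  by (induction ws) (simp_all add: gen_def mult_single plus_free_monoid_def flip: zero_free_monoid_def)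

lemma substitute_eq_self:
  assumes "p \<in> carrier (free_algebra G)" "\<And>g. g \<in> G \<Longrightarrow> f g = gen g"
  shows "substitute f p = p"
proof -
  have "map f (letters w) = map gen (letters w)" if "w \<in> Poly_Mapping.keys p" for w
    using assms that by (auto simp: free_algebra_def subset_iff)
  then have "substitute f p = substitute gen p"
    unfolding substitute_def by (intro sum.cong refl) (simp only:)
  also have "\<dots> = p"
    by (induction p rule: nc_poly_induct)
      (simp_all add: substitute_add substitute_single prod_list_gen const_def mult_single)
  finally show ?thesis .
qed

lemma free_algebra_simps [simp]:
  "mult (free_algebra G) = (*)" "one (free_algebra G) = 1" "zero (free_algebra G) = 0"
  "add (free_algebra G) = (+)" "smult (free_algebra G) = (\<lambda>c p. const c * p)"
  by (simp_all add: free_algebra_def)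

lemma free_algebra_UNIV [simp]: "carrier (free_algebra UNIV) = UNIV"
  by (simp add: free_algebra_def)

lemma free_algebra_closed:
  "1 \<in> carrier (free_algebra G)" "0 \<in> carrier (free_algebra G)" "const c \<in> carrier (free_algebra G)"
  "g \<in> G \<Longrightarrow> gen g \<in> carrier (free_algebra G)"
  "p \<in> carrier (free_algebra G) \<Longrightarrow> - p \<in> carrier (free_algebra G)"
  "\<lbrakk>p \<in> carrier (free_algebra G); q \<in> carrier (free_algebra G)\<rbrakk> \<Longrightarrow> p + q \<in> carrier (free_algebra G)"
  "\<lbrakk>p \<in> carrier (free_algebra G); q \<in> carrier (free_algebra G)\<rbrakk> \<Longrightarrow> p * q \<in> carrier (free_algebra G)"
proof -
  show "const c \<in> carrier (free_algebra G)" for c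
    by (simp add: free_algebra_def const_def zero_free_monoid_def)
  from this[of 1] this[of 0] show "1 \<in> carrier (free_algebra G)" "0 \<in> carrier (free_algebra G)"
    by (simp_all add: const_simps)
  show "g \<in> G \<Longrightarrow> gen g \<in> carrier (free_algebra G)"
    by (simp add: free_algebra_def gen_def)
  show "p \<in> carrier (free_algebra G) \<Longrightarrow> - p \<in> carrier (free_algebra G)"
    by (simp add: free_algebra_def)
  show "\<lbrakk>p \<in> carrier (free_algebra G); q \<in> carrier (free_algebra G)\<rbrakk> \<Longrightarrow> p + q \<in> carrier (free_algebra G)"
    using Poly_Mapping.keys_add[of p q] by (auto simp: free_algebra_def)
  show "\<lbrakk>p \<in> carrier (free_algebra G); q \<in> carrier (free_algebra G)\<rbrakk> \<Longrightarrow> p * q \<in> carrier (free_algebra G)"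
    using keys_mult[of p q] by (force simp: free_algebra_def plus_free_monoid_def)
qed

lemma free_algebra_closed_diff:
  "\<lbrakk>p \<in> carrier (free_algebra G); q \<in> carrier (free_algebra G)\<rbrakk> \<Longrightarrow> p - q \<in> carrier (free_algebra G)"
  using free_algebra_closed(5,6)[of _ G] by (metis diff_conv_add_uminus)

lemma free_algebra_closed_commutator:
  "\<lbrakk>p \<in> carrier (free_algebra G); q \<in> carrier (free_algebra G)\<rbrakk> \<Longrightarrow> commutator p q \<in> carrier (free_algebra G)"
  by (simp add: commutator_def free_algebra_closed_diff free_algebra_closed)

lemma substitute_closed:
  assumes "\<And>g. f g \<in> carrier (free_algebra G)"
  shows "substitute f p \<in> carrier (free_algebra G)"
proof (induction p rule: nc_poly_induct)
  case (single w c)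
  have "prod_list (map f w) \<in> carrier (free_algebra G)"
    by (induction w) (simp_all add: assms free_algebra_closed)
  then show ?case by (simp add: substitute_single free_algebra_closed)
qed (simp add: substitute_add free_algebra_closed)

lemma ring_free_algebra: "ring (free_algebra G)"
proof (rule ringI)
  show "abelian_group (free_algebra G)"
  proof (rule abelian_groupI)
    fix p
    assume "p \<in> carrier (free_algebra G)"
    then show "\<exists>q\<in>carrier (free_algebra G). q \<oplus>\<^bsub>free_algebra G\<^esub> p = \<zero>\<^bsub>free_algebra G\<^esub>"
      by (intro bexI[of _ "- p"]) (simp_all add: free_algebra_closed)
  qed (simp_all add: free_algebra_closed algebra_simps)
  show "Group.monoid (free_algebra G)"
    by (rule monoidI) (simp_all add: free_algebra_closed mult.assoc)
qed (simp_all add: algebra_simps)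

lemma a_inv_free_algebra:
  assumes "p \<in> carrier (free_algebra G)"
  shows "\<ominus>\<^bsub>free_algebra G\<^esub> p = - p"
proof -
  interpret ring "free_algebra G" by (rule ring_free_algebra)
  show ?thesis
    using assms minus_equality[of "- p" p] by (simp add: free_algebra_closed)
qed

lemma ideal_free_algebraI:
  assumes "J \<subseteq> carrier (free_algebra G)" "0 \<in> J" "\<And>p q. p \<in> J \<Longrightarrow> q \<in> J \<Longrightarrow> p + q \<in> J"
    and "\<And>a p. p \<in> J \<Longrightarrow> a \<in> carrier (free_algebra G) \<Longrightarrow> a * p \<in> J"
    and "\<And>a p. p \<in> J \<Longrightarrow> a \<in> carrier (free_algebra G) \<Longrightarrow> p * a \<in> J"
  shows "ideal J (free_algebra G)"
proof (rule idealI[OF ring_free_algebra])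
  interpret ring "free_algebra G" by (rule ring_free_algebra)
  have neg: "- p \<in> J" if "p \<in> J" for p
    using assms(4)[OF that, of "- 1"] by (simp add: free_algebra_closed)
  show "subgroup J (add_monoid (free_algebra G))"
  proof (rule add.subgroupI)
    fix p
    assume "p \<in> J"
    then show "\<ominus>\<^bsub>free_algebra G\<^esub> p \<in> J"
      using assms(1) neg by (subst a_inv_free_algebra) auto
  qed (use assms in auto)
qed (use assms in auto)

lemma ideal_free_algebraD:
  assumes "ideal J (free_algebra G)"
  shows "0 \<in> J" and "\<And>p q. p \<in> J \<Longrightarrow> q \<in> J \<Longrightarrow> p + q \<in> J"
    and "\<And>p q. p \<in> J \<Longrightarrow> q \<in> J \<Longrightarrow> p - q \<in> J"
    and "\<And>a p. p \<in> J \<Longrightarrow> a \<in> carrier (free_algebra G) \<Longrightarrow> a * p \<in> J"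
    and "\<And>a p. p \<in> J \<Longrightarrow> a \<in> carrier (free_algebra G) \<Longrightarrow> p * a \<in> J"
    and "J \<subseteq> carrier (free_algebra G)"
proof -
  interpret ideal J "free_algebra G" by fact
  show "0 \<in> J" using additive_subgroup.zero_closed[OF additive_subgroup_axioms] by simp
  show add: "\<And>p q. p \<in> J \<Longrightarrow> q \<in> J \<Longrightarrow> p + q \<in> J"
    using additive_subgroup.a_closed[OF additive_subgroup_axioms] by simp
  show mult: "\<And>a p. p \<in> J \<Longrightarrow> a \<in> carrier (free_algebra G) \<Longrightarrow> a * p \<in> J" using I_l_closed by simp
  show "\<And>a p. p \<in> J \<Longrightarrow> a \<in> carrier (free_algebra G) \<Longrightarrow> p * a \<in> J" using I_r_closed by simp
  show "J \<subseteq> carrier (free_algebra G)" by (rule a_subset)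
  fix p q
  assume "p \<in> J" "q \<in> J"
  then have "p + - 1 * q \<in> J" by (intro add mult) (simp_all add: free_algebra_closed)
  then show "p - q \<in> J" by simp
qed

section \<open>Quotients of free algebras as algebras of endomorphisms\<close>

typedef 'g endo =
  "{f :: 'g nc_poly \<Rightarrow> 'g nc_poly. (\<forall>p q. f (p + q) = f p + f q) \<and> (\<forall>c p. f (const c * p) = const c * f p)}"
  by (rule exI[of _ id]) simp

setup_lifting type_definition_endo

instantiation endo :: (type) real_algebra_1
begin

lift_definition zero_endo :: "'a endo" is "\<lambda>_. 0" by simp
lift_definition one_endo :: "'a endo" is "\<lambda>p. p" by simp
lift_definition plus_endo :: "'a endo \<Rightarrow> 'a endo \<Rightarrow> 'a endo" is "\<lambda>f g p. f p + g p"
  by (simp add: algebra_simps)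
lift_definition uminus_endo :: "'a endo \<Rightarrow> 'a endo" is "\<lambda>f p. - f p"
  by simp
lift_definition minus_endo :: "'a endo \<Rightarrow> 'a endo \<Rightarrow> 'a endo" is "\<lambda>f g p. f p - g p"
  by (simp add: algebra_simps)
lift_definition times_endo :: "'a endo \<Rightarrow> 'a endo \<Rightarrow> 'a endo" is "\<lambda>f g p. f (g p)"
  by simp
lift_definition scaleR_endo :: "real \<Rightarrow> 'a endo \<Rightarrow> 'a endo" is "\<lambda>t f p. const (of_real t) * f p"
  by (simp add: algebra_simps) (metis const_central mult.assoc)

instance
proof
  show "(0::'a endo) \<noteq> 1"
  proof
    assume "(0::'a endo) = 1"
    then have "Rep_endo (0::'a endo) 1 = Rep_endo 1 1" by simp
    then show False by (simp add: zero_endo.rep_eq one_endo.rep_eq)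
  qed
qed (transfer; simp add: fun_eq_iff const_simps algebra_simps)+

end

lemma ideal_projection:
  fixes J :: "'g nc_poly set"
  assumes "ideal J (free_algebra UNIV)"
  obtains \<pi> where "\<And>p q. \<pi> (p + q) = \<pi> p + \<pi> q" "\<And>c p. \<pi> (const c * p) = const c * \<pi> p"
    "\<And>p. \<pi> p = 0 \<longleftrightarrow> p \<in> J" "\<And>p. p - \<pi> p \<in> J"
proof -
  note J = ideal_free_algebraD[OF assms]
  interpret vector_space "\<lambda>c (p :: 'g nc_poly). const c * p"
    by standard (simp_all add: const_simps algebra_simps)
  interpret vector_space_pair "\<lambda>c (p :: 'g nc_poly). const c * p" "\<lambda>c (p :: 'g nc_poly). const c * p" ..
  have "subspace J"
    using J by (simp add: subspace_def)
  moreover have "Vector_Spaces.linear (\<lambda>c (p :: 'g nc_poly). const c * p) (\<lambda>c (p :: 'g nc_poly). const c * p) (\<lambda>p. p)"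
    by (rule linear_ident)
  ultimately obtain g where g: "range g \<subseteq> J"
      "Vector_Spaces.linear (\<lambda>c (p :: 'g nc_poly). const c * p) (\<lambda>c (p :: 'g nc_poly). const c * p) g"
      "\<And>v. v \<in> J \<Longrightarrow> g v = v"
    using linear_exists_left_inverse_on[of "\<lambda>p. p" J] by (auto simp: inj_on_def)
  interpret g: Vector_Spaces.linear "\<lambda>c (p :: 'g nc_poly). const c * p" "\<lambda>c (p :: 'g nc_poly). const c * p" g
    by (rule g)
  show thesis
  proof (rule that[of "\<lambda>p. p - g p"])
    show "p - g p = 0 \<longleftrightarrow> p \<in> J" for p
      using g(1,3) by (metis eq_iff_diff_eq_0 rangeI subsetD)
    show "p - (p - g p) \<in> J" for p
      using g(1) by auto
  qed (simp_all add: g.add g.scale right_diff_distrib)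
qed

locale algebra_map = ring_map h for h :: "'g nc_poly \<Rightarrow> 'a::real_algebra_1" +
  assumes scale: "h (const (of_real t) * p) = t *\<^sub>R h p"

text \<open>
  Let \<open>\<pi>\<close> be a linear projection with kernel \<open>J\<close>, and let \<open>a\<close> act by \<open>p \<mapsto> \<pi> (a * p)\<close>. As \<open>J\<close> is
  a two-sided ideal, this respects products, and \<open>a\<close> acts by zero exactly if it belongs
  to \<open>J\<close>, as one sees on \<open>p = 1\<close>. The homomorphism sends \<open>1\<close> to \<open>\<pi>\<close> and not to the identity, which is
  why \<open>algebra_map\<close> does not require units to be preserved.
\<close>
lemma ideal_is_kernel:
  assumes "ideal J (free_algebra UNIV)"
  obtains h :: "'g nc_poly \<Rightarrow> 'g endo" where "algebra_map h" "\<And>p. h p = 0 \<longleftrightarrow> p \<in> J"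
proof -
  note J = ideal_free_algebraD[OF assms, simplified]
  obtain \<pi> where \<pi>: "\<And>p q. \<pi> (p + q) = \<pi> p + \<pi> q" "\<And>c p. \<pi> (const c * p) = const c * \<pi> p"
    "\<And>p. \<pi> p = 0 \<longleftrightarrow> p \<in> J" "\<And>p. p - \<pi> p \<in> J"
    using ideal_projection[OF assms] by metis
  have \<pi>_diff: "\<pi> (p - q) = \<pi> p - \<pi> q" for p q
    using \<pi>(1)[of "p - q" q] by (simp add: algebra_simps)
  have \<pi>_mult: "\<pi> (a * \<pi> p) = \<pi> (a * p)" for a p
  proof -
    have "\<pi> (a * (p - \<pi> p)) = 0" by (simp add: \<pi>(3) J \<pi>(4))
    then show ?thesis by (simp add: right_diff_distrib \<pi>_diff)
  qed
  define h where "h = (\<lambda>a. Abs_endo (\<lambda>p. \<pi> (a * p)))"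
  have Rep: "Rep_endo (h a) = (\<lambda>p. \<pi> (a * p))" for a
    unfolding h_def
    by (rule Abs_endo_inverse) (simp add: \<pi> distrib_left, metis \<pi>(2) const_central mult.assoc)
  show thesis
  proof (rule that[of h])
    show "algebra_map h"
    proof
      show "h (p + q) = h p + h q" for p q
        by (simp add: Rep_endo_inject[symmetric] plus_endo.rep_eq Rep \<pi> distrib_right)
      show "h (p * q) = h p * h q" for p q
        by (simp add: Rep_endo_inject[symmetric] times_endo.rep_eq Rep \<pi>_mult mult.assoc)
      show "h (const (of_real t) * p) = t *\<^sub>R h p" for t p
        by (simp add: Rep_endo_inject[symmetric] scaleR_endo.rep_eq Rep \<pi> mult.assoc)
    qed
    show "h a = 0 \<longleftrightarrow> a \<in> J" for a
    proof
      assume "h a = 0"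
      then have "Rep_endo (h a) 1 = 0" by (simp add: zero_endo.rep_eq)
      then show "a \<in> J" by (simp add: Rep \<pi>)
    next
      assume "a \<in> J"
      then show "h a = 0"
        by (simp add: Rep_endo_inject[symmetric] zero_endo.rep_eq Rep \<pi> J fun_eq_iff)
    qed
  qed
qed

text \<open>
  A retraction \<open>\<theta>\<close> of the big free algebra onto the small one induces the isomorphism. It is
  surjective because \<open>\<theta>\<close> fixes the small algebra, and injective by the condition on the ideals.
\<close>
lemma quotient_algebras_isomorphic:
  fixes \<theta> :: "'g nc_poly \<Rightarrow> 'g nc_poly"
  assumes I: "ideal I (free_algebra UNIV)" and J: "ideal J (free_algebra G)"
    and \<theta>: "ring_map \<theta>" "\<theta> 1 = 1" "\<And>c p. \<theta> (const c * p) = const c * \<theta> p"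
    and closed: "\<And>p. \<theta> p \<in> carrier (free_algebra G)"
    and self: "\<And>p. p \<in> carrier (free_algebra G) \<Longrightarrow> \<theta> p = p"
    and kernel: "\<And>p. \<theta> p \<in> J \<longleftrightarrow> p \<in> I"
  shows "algebras_isomorphic (quotient_algebra (free_algebra UNIV) I) (quotient_algebra (free_algebra G) J)"
proof -
  interpret \<theta>: ring_map \<theta> by fact
  interpret F: ring "free_algebra (UNIV :: 'g set)" by (rule ring_free_algebra)
  interpret E: ring "free_algebra G" by (rule ring_free_algebra)
  interpret I: ideal I "free_algebra UNIV" by fact
  interpret J: ideal J "free_algebra G" by fact
  note JD = ideal_free_algebraD[OF J]
  let ?F = "free_algebra (UNIV :: 'g set)" and ?E = "free_algebra G"
  define h where "h = (\<lambda>p. J +>\<^bsub>?E\<^esub> \<theta> p)"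
  have coset_eq: "J +>\<^bsub>?E\<^esub> p = J +>\<^bsub>?E\<^esub> q \<longleftrightarrow> p - q \<in> J" if "p \<in> carrier ?E" "q \<in> carrier ?E" for p q
    using J.a_rcos_module_minus[OF E.ring_axioms that(2) that(1)] that
      J.a_repr_independence'[of p q] J.a_rcos_self[OF that(1)]
    by (auto simp: a_minus_def a_inv_free_algebra)
  have "h \<in> ring_hom ?F (?E Quot J)"
    unfolding h_def
    using ring_hom_memE[OF J.rcos_ring_hom]
    by (intro ring_hom_memI) (simp_all add: closed \<theta>.simps \<theta>(2) free_algebra_closed)
  then interpret h: ring_hom_ring ?F "?E Quot J" h
    by (intro ring_hom_ringI2 F.ring_axioms J.quotient_is_ring)
  have ker: "a_kernel ?F (?E Quot J) h = I"
  proof -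
    have "h p = J \<longleftrightarrow> p \<in> I" for p
      using coset_eq[OF closed free_algebra_closed(2), of p] J.a_rcos_const[of 0] JD(1)
      by (simp add: h_def kernel)
    moreover have "\<zero>\<^bsub>?E Quot J\<^esub> = J" by (simp add: FactRing_def)
    ultimately show ?thesis unfolding a_kernel_def' free_algebra_UNIV by blast
  qed
  have surj: "h ` carrier ?F = carrier (?E Quot J)"
  proof
    show "h ` carrier ?F \<subseteq> carrier (?E Quot J)"
      using h.hom_closed by blast
    show "carrier (?E Quot J) \<subseteq> h ` carrier ?F"
    proof
      fix Y
      assume "Y \<in> carrier (?E Quot J)"
      then obtain p where "p \<in> carrier ?E" "Y = J +>\<^bsub>?E\<^esub> p"
        by (auto simp: FactRing_def A_RCOSETS_def')
      then have "Y = h p" by (simp add: h_def self)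
      then show "Y \<in> h ` carrier ?F" by simp
    qed
  qed
  let ?\<phi> = "\<lambda>X. the_elem (h ` X)"
  have iso: "?\<phi> \<in> ring_iso (?F Quot I) (?E Quot J)"
    using h.FactRing_iso_set[OF surj] unfolding ker .
  have \<phi>: "?\<phi> (I +>\<^bsub>?F\<^esub> p) = h p" for p
  proof -
    have "h q = h p" if "q \<in> I +>\<^bsub>?F\<^esub> p" for q
    proof -
      from that obtain a where "a \<in> I" "q = a + p"
        by (auto simp: a_r_coset_def')
      then show ?thesis
        unfolding h_def by (subst coset_eq[OF closed closed]) (simp add: \<theta>.add kernel)
    qed
    moreover have "p \<in> I +>\<^bsub>?F\<^esub> p" by (rule I.a_rcos_self) simp
    ultimately have "h ` (I +>\<^bsub>?F\<^esub> p) = {h p}" by blast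
    then show ?thesis by simp
  qed
  have smult_F: "smult (quotient_algebra ?F I) c (I +>\<^bsub>?F\<^esub> p) = I +>\<^bsub>?F\<^esub> (const c * p)" for c p
  proof -
    have "I +>\<^bsub>?F\<^esub> (const c * q) = I +>\<^bsub>?F\<^esub> (const c * p)" if "q \<in> I +>\<^bsub>?F\<^esub> p" for q
    proof -
      from that obtain a where "a \<in> I" "q = a + p" by (auto simp: a_r_coset_def')
      then have "const c * q \<in> I +>\<^bsub>?F\<^esub> (const c * p)"
        using ideal_free_algebraD(4)[OF I, of a "const c"] by (auto simp: a_r_coset_def' distrib_left)
      then show ?thesis using I.a_repr_independence'[of "const c * q" "const c * p"] by simp
    qed
    moreover have "p \<in> I +>\<^bsub>?F\<^esub> p" by (rule I.a_rcos_self) simp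
    ultimately have "(\<Union>q\<in>I +>\<^bsub>?F\<^esub> p. I +>\<^bsub>?F\<^esub> (const c * q)) = I +>\<^bsub>?F\<^esub> (const c * p)"
      by blast
    then show ?thesis by (simp only: quotient_algebra_def module.simps free_algebra_simps)
  qed
  have smult_E: "smult (quotient_algebra ?E J) c (J +>\<^bsub>?E\<^esub> p) = J +>\<^bsub>?E\<^esub> (const c * p)"
    if p: "p \<in> carrier ?E" for c p
  proof -
    have "J +>\<^bsub>?E\<^esub> (const c * q) = J +>\<^bsub>?E\<^esub> (const c * p)" if "q \<in> J +>\<^bsub>?E\<^esub> p" for q
    proof -
      from that obtain a where a: "a \<in> J" "q = a + p" by (auto simp: a_r_coset_def')
      then have "const c * q \<in> J +>\<^bsub>?E\<^esub> (const c * p)"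
        using JD(4)[of a "const c"] by (auto simp: a_r_coset_def' distrib_left free_algebra_closed)
      then show ?thesis
        using J.a_repr_independence'[of "const c * q" "const c * p"] p by (simp add: free_algebra_closed)
    qed
    moreover have "p \<in> J +>\<^bsub>?E\<^esub> p" by (rule J.a_rcos_self[OF p])
    ultimately have "(\<Union>q\<in>J +>\<^bsub>?E\<^esub> p. J +>\<^bsub>?E\<^esub> (const c * q)) = J +>\<^bsub>?E\<^esub> (const c * p)"
      by blast
    then show ?thesis by (simp only: quotient_algebra_def module.simps free_algebra_simps)
  qed
  have "?\<phi> \<in> algebra_iso (quotient_algebra ?F I) (quotient_algebra ?E J)"
    unfolding algebra_iso_def
  proof (intro CollectI conjI allI ballI)
    show "?\<phi> \<in> ring_iso (quotient_algebra ?F I) (quotient_algebra ?E J)"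
      using iso by (simp add: ring_iso_def ring_hom_def quotient_algebra_def)
    fix c X
    assume "X \<in> carrier (quotient_algebra ?F I)"
    then obtain p where X: "X = I +>\<^bsub>?F\<^esub> p"
      by (auto simp: quotient_algebra_def FactRing_def A_RCOSETS_def')
    show "?\<phi> (c \<odot>\<^bsub>quotient_algebra ?F I\<^esub> X) = c \<odot>\<^bsub>quotient_algebra ?E J\<^esub> ?\<phi> X"
      unfolding X smult_F \<phi> unfolding h_def smult_E[OF closed] \<theta>(3) ..
  qed
  then show ?thesis by (auto simp: algebras_isomorphic_def)
qed

section \<open>Eliminating the generators of higher degree\<close>

lemma ideal_Idl: "R \<subseteq> carrier (free_algebra G) \<Longrightarrow> ideal (Idl\<^bsub>free_algebra G\<^esub> R) (free_algebra G)"
  by (rule ring.genideal_ideal[OF ring_free_algebra])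

lemma subset_Idl: "R \<subseteq> carrier (free_algebra G) \<Longrightarrow> R \<subseteq> Idl\<^bsub>free_algebra G\<^esub> R"
  by (rule ring.genideal_self[OF ring_free_algebra])

lemma Idl_minimal: "ideal I (free_algebra G) \<Longrightarrow> R \<subseteq> I \<Longrightarrow> Idl\<^bsub>free_algebra G\<^esub> R \<subseteq> I"
  by (rule ring.genideal_minimal[OF ring_free_algebra])

fun X_poly :: "('i \<Rightarrow> 'i \<Rightarrow> real) \<Rightarrow> sign \<Rightarrow> 'i \<Rightarrow> nat \<Rightarrow> 'i ygen nc_poly" where
  "X_poly B e i 0 = xg e i 0"
| "X_poly B e i (Suc 0) = xg e i 1"
| "X_poly B e i (Suc (Suc r)) =
    const (of_real (sgn_of e / B i i)) * commutator (htilde1 i) (X_poly B e i (Suc r))"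

fun H_poly :: "('i \<Rightarrow> 'i \<Rightarrow> real) \<Rightarrow> 'i \<Rightarrow> nat \<Rightarrow> 'i ygen nc_poly" where
  "H_poly B i 0 = hg i 0"
| "H_poly B i (Suc 0) = hg i 1"
| "H_poly B i (Suc (Suc r)) = commutator (X_poly B Plus i (Suc (Suc r))) (xg Minus i 0)"

fun reduced_poly :: "('i \<Rightarrow> 'i \<Rightarrow> real) \<Rightarrow> 'i ygen \<Rightarrow> 'i ygen nc_poly" where
  "reduced_poly B (Xgen e i r) = X_poly B e i r"
| "reduced_poly B (Hgen i r) = H_poly B i r"

abbreviation reduce :: "('i \<Rightarrow> 'i \<Rightarrow> real) \<Rightarrow> 'i ygen nc_poly \<Rightarrow> 'i ygen nc_poly" where
  "reduce B \<equiv> substitute (reduced_poly B)"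

lemma gen_reduced:
  "r \<le> 1 \<Longrightarrow> xg e i r \<in> carrier (free_algebra reduced_generators)"
  "r \<le> 1 \<Longrightarrow> hg i r \<in> carrier (free_algebra reduced_generators)"
  by (rule free_algebra_closed(4), force simp: reduced_generators_def le_Suc_eq)+

lemmas reduced_closed = gen_reduced free_algebra_closed(1-3,5-7) free_algebra_closed_diff
  free_algebra_closed_commutator

lemma htilde1_reduced: "htilde1 i \<in> carrier (free_algebra reduced_generators)"
  unfolding htilde1_def power2_eq_square by (intro reduced_closed) simp_all

lemma X_poly_reduced: "X_poly B e i r \<in> carrier (free_algebra reduced_generators)"
  by (induction r rule: X_poly.induct[of "\<lambda>_ _ _ r. _ r" B e i])
    (simp_all add: reduced_closed htilde1_reduced)

lemma reduce_closed: "reduce B p \<in> carrier (free_algebra reduced_generators)"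
proof (rule substitute_closed)
  fix g :: "'a ygen"
  show "reduced_poly B g \<in> carrier (free_algebra reduced_generators)"
  proof (cases g)
    case (Xgen e i r)
    then show ?thesis by (simp add: X_poly_reduced)
  next
    case (Hgen i r)
    then show ?thesis
      by (cases "(B, i, r)" rule: H_poly.cases)
        (simp_all add: reduced_closed X_poly_reduced del: X_poly.simps)
  qed
qed

lemma reduce_eq_self: "p \<in> carrier (free_algebra reduced_generators) \<Longrightarrow> reduce B p = p"
  by (erule substitute_eq_self) (auto simp: reduced_generators_def)

lemma commutator_funpow_reduced:
  assumes "p \<in> carrier (free_algebra G)" "q \<in> carrier (free_algebra G)"
  shows "(commutator p ^^ n) q \<in> carrier (free_algebra G)"
  by (induction n) (simp_all add: assms free_algebra_closed_commutator)

lemma reduced_relators_closed: "reduced_relators A B \<subseteq> carrier (free_algebra reduced_generators)"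
proof
  fix p
  assume "p \<in> reduced_relators A B"
  then show "p \<in> carrier (free_algebra reduced_generators)"
    by cases (auto intro!: reduced_closed htilde1_reduced commutator_funpow_reduced)
qed

lemma algebra_map_htilde1:
  assumes "algebra_map h"
  shows "h (htilde1 i) = h (hg i 1) - (1/2) *\<^sub>R (h (hg i 0) * h (hg i 0))"
proof -
  interpret algebra_map h by fact
  have "h (const (1/2) * (hg i 0 * hg i 0)) = (1/2) *\<^sub>R h (hg i 0 * hg i 0)"
    using scale[of "1/2"] by simp
  then show ?thesis by (simp add: htilde1_def power2_eq_square diff mult)
qed

lemma (in algebra_map) drinfeld_relator:
  "h (commutator x y - commutator z w - const (of_real t) * v) =
    commutator (h x) (h y) - commutator (h z) (h w) - t *\<^sub>R h v"
  by (simp add: diff commutator scale)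

text \<open>
  The locale \<open>reduced_yangian_elements\<close> is built for this instance: the images of the expressions for
  the Yangian generators under a homomorphism that kills the reduced relators.
\<close>
lemma reduced_yangian_elements_reduce:
  fixes A :: "'i::finite \<Rightarrow> 'i \<Rightarrow> int" and h :: "'i ygen nc_poly \<Rightarrow> 'a::real_algebra_1"
  assumes "\<And>i j. B i j = B j i" "\<And>i. B i i > 0"
    and "\<And>i j. i \<noteq> j \<Longrightarrow> B i i * B j j - B i j * B i j \<noteq> 0"
    and "\<And>i. \<exists>j. j \<noteq> i \<and> B i j \<noteq> 0"
    and h: "algebra_map h" and zero: "\<And>p. p \<in> reduced_relators A B \<Longrightarrow> h p = 0"
  shows "reduced_yangian_elements A B (\<lambda>e i r. h (X_poly B e i r)) (\<lambda>i r. h (H_poly B i r)) (\<lambda>i. h (htilde1 i))"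
proof -
  interpret h: algebra_map h by (rule h)
  have low: "X_poly B e i r = xg e i r" "H_poly B i r = hg i r" if "r \<le> 1" for e i r
    using that by (auto simp: le_Suc_eq)
  show ?thesis
  proof
    show "h (htilde1 i) = h (H_poly B i 1) - (1/2) *\<^sub>R (h (H_poly B i 0) * h (H_poly B i 0))" for i
      by (simp add: algebra_map_htilde1[OF h.algebra_map_axioms])
    show "commutator (h (H_poly B i r)) (h (H_poly B j s)) = 0" if "r \<le> 1" "s \<le> 1" for i j r s
      using zero[OF reduced_relators.hh[OF that, of i j]] that by (simp add: low h.simps)
    show "commutator (h (H_poly B i 0)) (h (X_poly B e j 0)) = (sgn_of e * B i j) *\<^sub>R h (X_poly B e j 0)" for i j e
      using zero[OF reduced_relators.h0x[of 0 i e j]] by (simp add: h.diff h.commutator h.scale del: of_real_mult of_real_divide)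
    show "commutator (h (X_poly B Plus i r)) (h (X_poly B Minus j s)) = (if i = j then h (H_poly B i (r + s)) else 0)"
      if "r + s \<le> 1" for i j r s
      using zero[OF reduced_relators.xpm[OF that, of i j]] that
      by (auto simp: low h.simps split: if_splits)
    show "commutator (h (htilde1 i)) (h (X_poly B e j 0)) = (sgn_of e * B i j) *\<^sub>R h (X_poly B e j 1)" for i j e
      using zero[OF reduced_relators.htx[of i e j]] by (simp add: h.diff h.commutator h.scale del: of_real_mult of_real_divide)
    show "drinfeld (sgn_of e * B i j / 2) (\<lambda>r. h (X_poly B e i r)) (\<lambda>r. h (X_poly B e j r)) 0 0 = 0" for i j e
      using zero[OF reduced_relators.xx[where e = e and i = i and j = j]]
      by (simp only: h.drinfeld_relator) (simp add: drinfeld_def h.simps)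
    show "(commutator (h (X_poly B e i 0)) ^^ nat (1 - A i j)) (h (X_poly B e j 0)) = 0" if "i \<noteq> j" for i j e
      using zero[OF reduced_relators.serre[where e = e, OF that]] by (simp add: h.commutator_funpow)
    show "h (X_poly B e i (Suc (Suc r))) = (sgn_of e / B i i) *\<^sub>R commutator (h (htilde1 i)) (h (X_poly B e i (Suc r)))" for i e r
      by (simp only: X_poly.simps h.scale h.commutator)
    show "h (H_poly B i (Suc (Suc r))) = commutator (h (X_poly B Plus i (Suc (Suc r)))) (h (X_poly B Minus i 0))" for i r
      by (simp only: X_poly.simps(1) H_poly.simps h.commutator)
  qed (use assms in auto)
qed

lemma yangian_relator_reduce_zero:
  assumes "algebra_map h"
    and "reduced_yangian_elements A B (\<lambda>e i r. h (X_poly B e i r)) (\<lambda>i r. h (H_poly B i r)) (\<lambda>i. h (htilde1 i))"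
    and "p \<in> yangian_relators A B"
  shows "h (reduce B p) = 0"
proof -
  interpret h: algebra_map h by fact
  interpret S: ring_map "reduce B" by (rule ring_map_substitute)
  interpret reduced_yangian_elements A B "\<lambda>e i r. h (X_poly B e i r)" "\<lambda>i r. h (H_poly B i r)" "\<lambda>i. h (htilde1 i)"
    by fact
  note simps = S.simps h.simps substitute_gen
  from assms(3) show ?thesis
  proof cases
    case (hh i r j s)
    then show ?thesis using H_H_all by (simp add: simps)
  next
    case (h0x i e j s)
    have "h (reduce B p) = h (reduce B (commutator (hg i 0) (xg e j s))) - (sgn_of e * B i j) *\<^sub>R h (reduce B (xg e j s))"
      unfolding h0x S.diff substitute_const h.diff h.scale ..
    then show ?thesis using H0_X by (simp add: simps)
  next
    case (xpm i r j s)
    then show ?thesis using X_X[of i r j s] by (simp add: simps)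
  next
    case (hx i r e j s)
    have "h (reduce B p) = h (reduce B (commutator (hg i (Suc r)) (xg e j s))) - h (reduce B (commutator (hg i r) (xg e j (Suc s))))
      - (sgn_of e * B i j / 2) *\<^sub>R h (reduce B (hg i r * xg e j s + xg e j s * hg i r))"
      unfolding hx S.diff substitute_const h.diff h.scale ..
    then show ?thesis using drinfeld_H_X[of e i j r s] by (simp add: simps drinfeld_def)
  next
    case (xx e i r j s)
    have "h (reduce B p) = h (reduce B (commutator (xg e i (Suc r)) (xg e j s))) - h (reduce B (commutator (xg e i r) (xg e j (Suc s))))
      - (sgn_of e * B i j / 2) *\<^sub>R h (reduce B (xg e i r * xg e j s + xg e j s * xg e i r))"
      unfolding xx S.diff substitute_const h.diff h.scale ..
    then show ?thesis using drinfeld_X_X[of e i j r s] by (simp add: simps drinfeld_def)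
  next
    case (serre i j b e r s)
    then show ?thesis using serre_all[of i j b e r s] by (simp add: simps sym_ad_def)
  qed
qed

text \<open>
  The reduced relations are instances of the Yangian relations, except for two kinds. The one for
  \<open>htilde1\<close> is the relation between \<open>hg i 0\<close> and \<open>hg i 1\<close> rewritten with the weight relation, and the
  symmetrized Serre relation in degree zero is \<open>fact b\<close> times the unsymmetrized one.
\<close>
lemma reduced_relator_zero:
  assumes "algebra_map h" and zero: "\<And>p. p \<in> yangian_relators A B \<Longrightarrow> h p = 0"
    and "p \<in> reduced_relators A B"
  shows "h p = 0"
proof -
  interpret h: algebra_map h by fact
  from assms(3) show ?thesis
  proof cases
    case (hh r s i j)
    then show ?thesis by (simp add: zero yangian_relators.hh)
  next
    case (h0x s i e j)
    then show ?thesis by (simp add: zero yangian_relators.h0x del: of_real_mult)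
  next
    case (xpm r s i j)
    then show ?thesis by (simp only: zero yangian_relators.xpm)
  next
    case (htx i e j)
    have "commutator (h (hg i 0)) (h (xg e j s)) = (sgn_of e * B i j) *\<^sub>R h (xg e j s)" for s
      using zero[OF yangian_relators.h0x[of i e j s]] by (simp add: h.diff h.commutator h.scale del: of_real_mult of_real_divide)
    moreover have "commutator (h (hg i 1)) (h (xg e j 0)) - commutator (h (hg i 0)) (h (xg e j 1))
      - (sgn_of e * B i j / 2) *\<^sub>R (h (hg i 0) * h (xg e j 0) + h (xg e j 0) * h (hg i 0)) = 0"
      using zero[OF yangian_relators.hx[of i 0 e j 0]] by (simp only: h.drinfeld_relator) (simp add: h.simps)
    ultimately show ?thesis
      using htx by (simp add: h.diff h.commutator h.scale algebra_map_htilde1[OF h.algebra_map_axioms] commutator_linear commutator_mult_right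
          scaleR_add_right diff_diff_eq del: of_real_mult)
  next
    case (xx e i j)
    then show ?thesis using zero[OF yangian_relators.xx[where r = 0 and s = 0]] by simp
  next
    case (serre i j e)
    define b where "b = nat (1 - A i j)"
    have fold: "foldr (\<lambda>k. commutator y) ks z = (commutator y ^^ length ks) z"
      for y z :: "'a ygen nc_poly" and ks :: "nat list"
      by (induction ks) simp_all
    have "h (\<Sum>\<sigma> | \<sigma> permutes {..<b}. foldr (\<lambda>k. commutator (xg e i ((\<lambda>_. 0) (\<sigma> k)))) [0..<b] (xg e j 0)) = 0"
      by (rule zero, rule yangian_relators.serre) (simp_all add: serre b_def)
    then have "(\<Sum>\<sigma> | \<sigma> permutes {..<b}. h p) = 0"
      by (simp only: h.sum fold length_upt diff_zero serre(1) b_def)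
    then have "real (fact b) *\<^sub>R h p = 0"
      by (simp only: sum_constant_scaleR card_permutations[OF card_lessThan finite_lessThan])
    then show ?thesis by simp
  qed
qed

lemma X_poly_yangian:
  assumes "algebra_map h" and zero: "\<And>p. p \<in> yangian_relators A B \<Longrightarrow> h p = 0" and "B i i > 0"
  shows "h (X_poly B e i r) = h (xg e i r)"
proof -
  interpret h: algebra_map h by fact
  show ?thesis
  proof (induction r rule: X_poly.induct[of "\<lambda>_ _ _ r. _ r" B e i])
    case (3 B' e' i' r)
    have h0: "commutator (h (hg i 0)) (h (xg e i s)) = (sgn_of e * B i i) *\<^sub>R h (xg e i s)" for s
      using zero[OF yangian_relators.h0x[of i e i s]] by (simp add: h.diff h.commutator h.scale del: of_real_mult of_real_divide)
    have "commutator (h (hg i 1)) (h (xg e i (Suc r))) - commutator (h (hg i 0)) (h (xg e i (Suc (Suc r))))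
      - (sgn_of e * B i i / 2) *\<^sub>R (h (hg i 0) * h (xg e i (Suc r)) + h (xg e i (Suc r)) * h (hg i 0)) = 0"
      using zero[OF yangian_relators.hx[of i 0 e i "Suc r"]] by (simp only: h.drinfeld_relator) (simp add: h.simps)
    then have "commutator (h (htilde1 i)) (h (xg e i (Suc r))) = (sgn_of e * B i i) *\<^sub>R h (xg e i (Suc (Suc r)))"
      using h0 by (simp add: algebra_map_htilde1[OF h.algebra_map_axioms] commutator_linear commutator_mult_right scaleR_add_right diff_diff_eq)
    then show ?case using 3 assms(3)
      by (simp add: h.scale h.commutator del: of_real_mult of_real_divide)
  qed simp_all
qed

text \<open>
  The recursions that define \<open>reduce\<close> hold in the Yangian, so \<open>reduce\<close> does not change residue classes
  there.
\<close>
lemma reduce_yangian: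
  assumes h: "algebra_map h" and zero: "\<And>p. p \<in> yangian_relators A B \<Longrightarrow> h p = 0" and B: "\<And>i. B i i > 0"
  shows "h (reduce B p) = h p"
proof -
  interpret h: algebra_map h by fact
  have gens: "h (reduced_poly B g) = h (gen g)" for g
  proof (cases g)
    case (Xgen e i r)
    then show ?thesis using X_poly_yangian[where B = B, OF h zero B] by simp
  next
    case (Hgen i r)
    have "h (H_poly B i (Suc (Suc r))) = h (hg i (Suc (Suc r)))" for r
      using zero[OF yangian_relators.xpm[of i "Suc (Suc r)" i 0]]
      by (simp only: H_poly.simps h.commutator X_poly_yangian[where B = B, OF h zero B]) (simp add: h.simps)
    with Hgen show ?thesis
      by (cases "(B, i, r)" rule: H_poly.cases) (simp_all del: H_poly.simps(3))
  qed
  show ?thesis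
  proof (induction p rule: nc_poly_induct)
    case (single w c)
    have "h (prod_list (map (reduced_poly B) w)) = h (prod_list (map gen w))"
      by (induction w) (simp_all add: h.mult gens)
    then have "h (reduce B (Poly_Mapping.single (Word w) c)) = h (const c * Poly_Mapping.single (Word w) 1)"
      by (simp add: substitute_single h.mult prod_list_gen)
    then show ?case by (simp add: const_def mult_single)
  qed (simp add: substitute_add h.add)
qed

lemma form_symmetric_positive_nondegenerate:
  fixes A :: "'i::finite \<Rightarrow> 'i \<Rightarrow> int"
  assumes form: "standard_form_on_simple_roots A B"
    and inv: "\<And>i j. i \<noteq> j \<Longrightarrow> invertible (principal_submatrix A i j)"
  shows "B i j = B j i" "B i i > 0" "i \<noteq> j \<Longrightarrow> B i i * B j j - B i j * B i j \<noteq> 0"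
proof -
  have sym: "B i j = B j i" for i j
    using form by (simp add: standard_form_on_simple_roots_def)
  have pos: "B i i > 0" for i
    using form by (simp add: standard_form_on_simple_roots_def)
  show "B i j = B j i" "B i i > 0" by (rule sym, rule pos)
  assume "i \<noteq> j"
  then have "det (principal_submatrix A i j) \<noteq> 0"
    using inv invertible_det_nz by blast
  then have "real_of_int (A i i) * real_of_int (A j j) - real_of_int (A i j) * real_of_int (A j i) \<noteq> 0"
    by (simp add: principal_submatrix_def det_2)
  moreover have "real_of_int (A k l) = 2 * B k l / B k k" for k l
    using form by (simp add: standard_form_on_simple_roots_def)
  ultimately show "B i i * B j j - B i j * B i j \<noteq> 0"
    using pos[of i] pos[of j] sym[of j i] by (simp add: field_simps)
qed

text \<open>
  An entry \<open>- 1\<close> is off the diagonal, so there are at least two indices, and by indecomposability no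
  index is isolated.
\<close>
lemma neighbour_exists:
  fixes A :: "'i::finite \<Rightarrow> 'i \<Rightarrow> int"
  assumes cartan: "generalized_cartan_matrix A" and ind: "indecomposable A"
    and form: "standard_form_on_simple_roots A B" and "\<exists>i j. A i j = -1"
  shows "\<exists>j. j \<noteq> i \<and> B i j \<noteq> 0"
proof -
  have AB: "real_of_int (A k l) = 2 * B k l / B k k" "B k l = B l k" "B k k > 0" for k l
    using form by (auto simp: standard_form_on_simple_roots_def)
  obtain k l where "A k l = -1" using assms(4) by blast
  moreover have "A k k = 2" using cartan by (simp add: generalized_cartan_matrix_def)
  ultimately have "k \<noteq> l" by auto
  then have "{i} \<noteq> UNIV" by (metis UNIV_I singletonD)
  then obtain j where "j \<in> - {i}" "\<not> (A i j = 0 \<and> A j i = 0)"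
    using ind unfolding indecomposable_def by (metis empty_not_insert singletonD)
  moreover have "B i j \<noteq> 0" if "\<not> (A i j = 0 \<and> A j i = 0)" for j
    using that AB(1)[of i j] AB(1)[of j i] AB(2)[of j i] by auto
  ultimately show ?thesis by blast
qed

theorem theorem2p13:
  fixes A :: "'i::finite \<Rightarrow> 'i \<Rightarrow> int" and B :: "'i \<Rightarrow> 'i \<Rightarrow> real"
  assumes "generalized_cartan_matrix A"
    and "indecomposable A"
    and "\<not> type_A1_1 A"
    and "standard_form_on_simple_roots A B"
    and "\<And>i j. i \<noteq> j \<Longrightarrow> invertible (principal_submatrix A i j)"
    and "\<exists>i j. A i j = -1"
  shows "algebras_isomorphic (yangian A B) (reduced_yangian A B)"
proof -
  have B: "B i j = B j i" "B i i > 0" "i \<noteq> j \<Longrightarrow> B i i * B j j - B i j * B i j \<noteq> 0" for i j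
    by (rule form_symmetric_positive_nondegenerate[OF assms(4)]; simp add: assms(5))+
  note neighbour = neighbour_exists[OF assms(1,2,4,6)]
  let ?F = "free_algebra (UNIV :: 'i ygen set)" and ?E = "free_algebra (reduced_generators :: 'i ygen set)"
  let ?I = "Idl\<^bsub>?F\<^esub> (yangian_relators A B)" and ?J = "Idl\<^bsub>?E\<^esub> (reduced_relators A B)"
  let ?J' = "Idl\<^bsub>?F\<^esub> (reduced_relators A B)"
  have I: "ideal ?I ?F" and J': "ideal ?J' ?F" and J: "ideal ?J ?E"
    by (rule ideal_Idl; simp add: reduced_relators_closed)+
  have R_I: "yangian_relators A B \<subseteq> ?I" and R_J': "reduced_relators A B \<subseteq> ?J'"
    and R_J: "reduced_relators A B \<subseteq> ?J"
    by (rule subset_Idl; simp add: reduced_relators_closed)+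
  \<comment> \<open>\<open>ideal_is_kernel\<close> concerns ideals of the full free algebra, so the reduced relators are
    first taken to generate an ideal \<open>?J'\<close> there. Since \<open>reduce\<close> is idempotent and maps
    \<open>?J'\<close> into \<open>?J\<close>, membership of \<open>reduce B p\<close> in \<open>?J'\<close> gives membership in \<open>?J\<close>.\<close>
  interpret S: ring_map "reduce B" by (rule ring_map_substitute)
  have preimage: "ideal {p. reduce B p \<in> ?J} ?F"
    using ideal_free_algebraD[OF J]
    by (intro ideal_free_algebraI) (auto simp: S.simps reduce_closed)
  obtain u :: "'i ygen nc_poly \<Rightarrow> 'i ygen endo" where u: "algebra_map u" "\<And>p. u p = 0 \<longleftrightarrow> p \<in> ?J'"
    using ideal_is_kernel[OF J'] by metis
  obtain v :: "'i ygen nc_poly \<Rightarrow> 'i ygen endo" where v: "algebra_map v" "\<And>p. v p = 0 \<longleftrightarrow> p \<in> ?I"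
    using ideal_is_kernel[OF I] by metis
  interpret v: algebra_map v by (rule v)
  have v_zero: "v p = 0" if "p \<in> yangian_relators A B" for p
    using that R_I v(2) by blast
  have "?J' \<subseteq> {p. reduce B p \<in> ?J}"
  proof (rule Idl_minimal[OF preimage])
    show "reduced_relators A B \<subseteq> {p. reduce B p \<in> ?J}"
    proof
      fix p
      assume p: "p \<in> reduced_relators A B"
      then have "reduce B p = p" using reduced_relators_closed reduce_eq_self by blast
      with p R_J show "p \<in> {p. reduce B p \<in> ?J}" by auto
    qed
  qed
  moreover have "reduce B p \<in> ?J'" if "p \<in> yangian_relators A B" for p
  proof -
    have "reduced_yangian_elements A B (\<lambda>e i r. u (X_poly B e i r)) (\<lambda>i r. u (H_poly B i r)) (\<lambda>i. u (htilde1 i))"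
      using u R_J' by (intro reduced_yangian_elements_reduce B neighbour) blast+
    then have "u (reduce B p) = 0"
      using that by (rule yangian_relator_reduce_zero[OF u(1)])
    then show ?thesis using u(2) by blast
  qed
  ultimately have twice: "reduce B (reduce B p) \<in> ?J" if "p \<in> yangian_relators A B" for p
    using that by blast
  then have "reduce B p \<in> ?J" if "p \<in> yangian_relators A B" for p
    using twice[OF that] reduce_eq_self[OF reduce_closed[of B p], of B] by simp
  then have I_J: "?I \<subseteq> {p. reduce B p \<in> ?J}"
    by (intro Idl_minimal[OF preimage]) blast
  have "ideal (?I \<inter> carrier ?E) ?E"
    using ideal_free_algebraD[OF I] by (intro ideal_free_algebraI) (auto intro: free_algebra_closed)
  moreover have "reduced_relators A B \<subseteq> ?I \<inter> carrier ?E"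
    using reduced_relator_zero[OF v(1) v_zero] v(2) reduced_relators_closed by blast
  ultimately have J_I: "?J \<subseteq> ?I" using Idl_minimal by blast
  have kernel: "reduce B p \<in> ?J \<longleftrightarrow> p \<in> ?I" for p
  proof
    assume "reduce B p \<in> ?J"
    with J_I have "v (reduce B p) = 0" using v(2) by blast
    then show "p \<in> ?I" using reduce_yangian[where B = B and p = p, OF v(1) v_zero B(2)] v(2) by simp
  qed (use I_J in blast)
  show ?thesis
    unfolding yangian_def reduced_yangian_def presented_algebra_def
    by (rule quotient_algebras_isomorphic[OF I J ring_map_substitute substitute_one substitute_const
          reduce_closed reduce_eq_self kernel])
qed

end
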